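(* Let $K\ge 1$, and let $u^{\{K\}}$ and $U^{\{K\}}$ be the continuum and the discrete global iterates after $K$ iterations of the overlapping multiplicative Schwarz method with $p$ subdomains, started from the same initial guess. Let $\widetilde U^{\{k+i/p\}}$ be the local discrete solutions and let $\phi^{[k+i/p]}\in H^1_0(\Omega_i)$, $0\le k\le K-1$, $1\le i\le p$, be the solutions of the sequence of multiplicative adjoint problems associated with the quantity-of-interest data $\psi\in L_2(\Omega)$ (all defined in the context). Then $$\left(\psi, u^{\{K\}} - U^{\{K\}}\right) = \sum_{k=0}^{K-1} \sum_{i=1}^p R_i\left(\widetilde{U}^{\{k+i/p\}},\ \phi^{[k+i/p]} - \pi_i \phi^{[k+i/p]}\right),$$ where $\pi_i v\in V_{i,h,0}$ denotes the approximation of $v\in H^1_0(\Omega_i)$ in $V_{i,h,0}$, and $R_i(s,v)=l_i(v)-a_i(s,v)$.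
   Context: Problem. $\Omega$ is a bounded domain covered by $p$ overlapping open subdomains $\Omega_1,\dots,\Omega_p$: $\cup_i\Omega_i=\Omega$, and for every $i$ there is $j\neq i$ with $\Omega_i\cap\Omega_j\neq\emptyset$. $(\cdot,\cdot)$ and $(\cdot,\cdot)_{ij}$ are the $L_2(\Omega)$ and $L_2(\Omega_i\cap\Omega_j)$ inner products. $a(\cdot,\cdot)$ is the standard bilinear form of a second-order linear elliptic PDE, $a(u,v)=\int_\Omega (A\nabla u\cdot\nabla v+(\mathbf b\cdot\nabla u)v+c\,uv)\,dx$ with bounded measurable coefficients (for Poisson: $\int_\Omega\nabla u\cdot\nabla v\,dx$; no symmetry is assumed), and $l(v)=(f,v)$ with $f\in L_2(\Omega)$. $a_i$, $a_{ij}$ are the restrictions of $a$ (same integrand) to $\Omega_i$ and $\Omega_i\cap\Omega_j$; $l_i$ is the restriction of $l$ to $\Omega_i$. All variational problems below are assumed uniquely solvable. Discretization. $\mathcal T_h$ is a conforming triangulation of $\Omega$ consistent with the decomposition (each $\overline{\Omega}_j$ is a union of elements). $V_h\subset H^1_0(\Omega)$ is a space of continuous piecewise polynomials (of a fixed degree) on $\mathcal T_h$; $V_{i,h,0}\subset H^1_0(\Omega_i)$ is the corresponding space of continuous piecewise polynomials on $\mathcal T_h|_{\Omega_i}$ vanishing on $\partial\Omega_i$. Multiplicative Schwarz. Start from $u^{\{0\}}=U^{\{0\}}\in V_h$. For $k=0,\dots,K-1$ and $i=1,\dots,p$: $\widetilde u^{\{k+i/p\}}\in H^1(\Omega_i)$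 satisfies $\widetilde u^{\{k+i/p\}}=u^{\{k+(i-1)/p\}}$ on $\partial\Omega_i$ and $a_i(\widetilde u^{\{k+i/p\}},v)=l_i(v)$ for all $v\in H^1_0(\Omega_i)$; then $u^{\{k+i/p\}}=\widetilde u^{\{k+i/p\}}$ on $\overline\Omega_i$ and $u^{\{k+i/p\}}=u^{\{k+(i-1)/p\}}$ on $\Omega\setminus\overline\Omega_i$. (Superscripts are read as numbers: $k+p/p=k+1$.) The discrete method is identical: $\widetilde U^{\{k+i/p\}}$ is a continuous piecewise polynomial on $\mathcal T_h|_{\Omega_i}$, equal to $U^{\{k+(i-1)/p\}}$ on $\partial\Omega_i$, with $a_i(\widetilde U^{\{k+i/p\}},v)=l_i(v)$ for all $v\in V_{i,h,0}$; and $U^{\{k+i/p\}}\in V_h$ equals $\widetilde U^{\{k+i/p\}}$ on $\overline\Omega_i$ and $U^{\{k+(i-1)/p\}}$ on $\Omega\setminus\overline\Omega_i$. Partition of the data. $\{\chi_i\}_{i=1}^p$ is a partition of unity on $\Omega$ ($\sum_i\chi_i=1$) with $\chi_i=0$ on $\Omega\setminus\Omega_i$, and $\psi_i=\chi_i\psi$, so $\psi_i=0$ on $\Omega\setminus\Omega_i$. (The paper's choice: $\chi_i=d_i/\sum_{j}d_j$ with $d_i(x)=\mathrm{dist}(x,\partial\Omega_i\cap\Omega)$ for $x\in\overline\Omega_i$ and $d_i(x)=0$ otherwise.) Adjoint problems. For $Q=K-1,K-2,\dots,0$ and, for each $Q$, $i=p,p-1,\dots,1$, $\phi^{[Q+i/p]}\in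 H^1_0(\Omega_i)$ solves $$a_i\left(v,\phi^{[Q+i/p]}\right)=\tau_i^Q(v)-\sum_{j=i+1}^p a_{ij}\left(v,\phi^{[Q+j/p]}\right)\quad\forall v\in H^1_0(\Omega_i)$$ (empty sum for $i=p$), where $\tau_i^{K-1}(v)=\sum_{j=1}^p(v,\psi_j)_{ij}$ and $\tau_i^Q(v)=-\sum_{j=1}^{i-1}a_{ij}\left(v,\phi^{[Q+1+j/p]}\right)$ for $0\le Q<K-1$. Here $\phi^{[Q+i/p]}$ always denotes the function indexed by the pair $(Q,i)$, $1\le i\le p$. *)

theory Defs
  imports "HOL-Analysis.Analysis"
begin

section \<open>Sobolev spaces\<close>

text \<open>
  A function on an open set \<open>S\<close> is represented by a total function; only its values
  (almost everywhere) on \<open>S\<close> matter in the definitions of this section.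
\<close>

definition L2 :: "(real ^ 'n) set \<Rightarrow> (real ^ 'n \<Rightarrow> 'b::euclidean_space) set" where
  "L2 S = {u. set_borel_measurable lebesgue S u \<and> set_integrable lebesgue S (\<lambda>x. (norm (u x))\<^sup>2)}"

definition L2_inner :: "(real ^ 'n) set \<Rightarrow> (real ^ 'n \<Rightarrow> real) \<Rightarrow> (real ^ 'n \<Rightarrow> real) \<Rightarrow> real" where
  "L2_inner S u v = (LINT x:S|lebesgue. u x * v x)"

definition partial :: "'n \<Rightarrow> (real ^ 'n \<Rightarrow> real) \<Rightarrow> real ^ 'n \<Rightarrow> real" where
  "partial j f x = frechet_derivative f (at x) (axis j 1)"

primrec C_k :: "nat \<Rightarrow> (real ^ 'n \<Rightarrow> real) \<Rightarrow> bool" where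
  "C_k 0 f \<longleftrightarrow> continuous_on UNIV f"
| "C_k (Suc k) f \<longleftrightarrow> (\<forall>x. f differentiable (at x)) \<and> (\<forall>j. C_k k (partial j f))"

definition test_functions :: "(real ^ 'n) set \<Rightarrow> (real ^ 'n \<Rightarrow> real) set" where
  "test_functions S =
    {v. (\<forall>k. C_k k v) \<and> (\<exists>C. compact C \<and> C \<subseteq> S \<and> (\<forall>x. x \<notin> C \<longrightarrow> v x = 0))}"

definition is_weak_gradient ::
    "(real ^ 'n) set \<Rightarrow> (real ^ 'n \<Rightarrow> real) \<Rightarrow> (real ^ 'n \<Rightarrow> real ^ 'n) \<Rightarrow> bool" where
  "is_weak_gradient S u G \<longleftrightarrow> G \<in> L2 S \<and>
    (\<forall>v \<in> test_functions S. \<forall>j.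
      (LINT x:S|lebesgue. u x * partial j v x) = - (LINT x:S|lebesgue. G x $ j * v x))"

definition H1 :: "(real ^ 'n) set \<Rightarrow> (real ^ 'n \<Rightarrow> real) set" where
  "H1 S = {u \<in> L2 S. \<exists>G. is_weak_gradient S u G}"

text \<open>The weak gradient is determined almost everywhere on \<open>S\<close>.\<close>

definition wgrad :: "(real ^ 'n) set \<Rightarrow> (real ^ 'n \<Rightarrow> real) \<Rightarrow> real ^ 'n \<Rightarrow> real ^ 'n" where
  "wgrad S u = (SOME G. is_weak_gradient S u G)"

definition H1_norm :: "(real ^ 'n) set \<Rightarrow> (real ^ 'n \<Rightarrow> real) \<Rightarrow> real" where
  "H1_norm S u = sqrt (LINT x:S|lebesgue. (u x)\<^sup>2 + (norm (wgrad S u x))\<^sup>2)"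

definition H10 :: "(real ^ 'n) set \<Rightarrow> (real ^ 'n \<Rightarrow> real) set" where
  "H10 S = {u \<in> H1 S. \<exists>s. (\<forall>n. s n \<in> test_functions S) \<and>
    (\<lambda>n. H1_norm S (\<lambda>x. s n x - u x)) \<longlonglongrightarrow> 0}"

section \<open>The elliptic problem\<close>

definition elliptic_coefficients ::
    "(real ^ 'n) set \<Rightarrow> (real ^ 'n \<Rightarrow> real ^ 'n ^ 'n) \<Rightarrow> (real ^ 'n \<Rightarrow> real ^ 'n) \<Rightarrow>
      (real ^ 'n \<Rightarrow> real) \<Rightarrow> bool" where
  "elliptic_coefficients \<Omega> A b c \<longleftrightarrow>
    set_borel_measurable lebesgue \<Omega> A \<and> bounded (A ` \<Omega>) \<and>
    set_borel_measurable lebesgue \<Omega> b \<and> bounded (b ` \<Omega>) \<and>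
    set_borel_measurable lebesgue \<Omega> c \<and> bounded (c ` \<Omega>) \<and>
    (\<exists>\<theta>>0. AE x in lebesgue. x \<in> \<Omega> \<longrightarrow> (\<forall>\<xi>. \<theta> * (norm \<xi>)\<^sup>2 \<le> (A x *v \<xi>) \<bullet> \<xi>))"

text \<open>
  The first set argument selects the domain of integration: with \<open>S\<close> being \<open>\<Omega>\<close>, a subdomain or an
  overlap of two subdomains one obtains \<open>a\<close>, \<open>a\<^sub>i\<close> and \<open>a\<^sub>i\<^sub>j\<close>. Arguments are restricted to \<open>S\<close>, so
  the weak gradient is taken on \<open>S\<close>.
\<close>

definition elliptic_form ::
    "(real ^ 'n \<Rightarrow> real ^ 'n ^ 'n) \<Rightarrow> (real ^ 'n \<Rightarrow> real ^ 'n) \<Rightarrow> (real ^ 'n \<Rightarrow> real) \<Rightarrow>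
      (real ^ 'n) set \<Rightarrow> (real ^ 'n \<Rightarrow> real) \<Rightarrow> (real ^ 'n \<Rightarrow> real) \<Rightarrow> real" where
  "elliptic_form A b c S u v =
    (LINT x:S|lebesgue. (A x *v wgrad S u x) \<bullet> wgrad S v x + (b x \<bullet> wgrad S u x) * v x + c x * u x * v x)"

definition residual ::
    "(real ^ 'n \<Rightarrow> real ^ 'n ^ 'n) \<Rightarrow> (real ^ 'n \<Rightarrow> real ^ 'n) \<Rightarrow> (real ^ 'n \<Rightarrow> real) \<Rightarrow>
      (real ^ 'n \<Rightarrow> real) \<Rightarrow> (real ^ 'n) set \<Rightarrow> (real ^ 'n \<Rightarrow> real) \<Rightarrow> (real ^ 'n \<Rightarrow> real) \<Rightarrow> real" where
  "residual A b c f S s v = L2_inner S f v - elliptic_form A b c S s v"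

section \<open>Decomposition and discretization\<close>

definition overlapping_decomposition ::
    "(real ^ 'n) set \<Rightarrow> nat \<Rightarrow> (nat \<Rightarrow> (real ^ 'n) set) \<Rightarrow> bool" where
  "overlapping_decomposition \<Omega> p \<omega> \<longleftrightarrow>
    (\<forall>i\<in>{1..p}. open (\<omega> i)) \<and> (\<Union>i\<in>{1..p}. \<omega> i) = \<Omega> \<and>
    (\<forall>i\<in>{1..p}. \<exists>j\<in>{1..p}. j \<noteq> i \<and> \<omega> i \<inter> \<omega> j \<noteq> {})"

text \<open>
  Conformity (two elements meet in a common face) is part of \<open>triangulation\<close>.
\<close>

definition conforming_mesh :: "(real ^ 'n) set set \<Rightarrow> (real ^ 'n) set \<Rightarrow> bool" where
  "conforming_mesh \<T> \<Omega> \<longleftrightarrow>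
    triangulation \<T> \<and> (\<forall>\<tau>\<in>\<T>. int CARD('n) simplex \<tau>) \<and> \<Union>\<T> = closure \<Omega>"

definition mesh_consistent ::
    "(real ^ 'n) set set \<Rightarrow> nat \<Rightarrow> (nat \<Rightarrow> (real ^ 'n) set) \<Rightarrow> bool" where
  "mesh_consistent \<T> p \<omega> \<longleftrightarrow> (\<forall>j\<in>{1..p}. \<exists>\<T>'\<subseteq>\<T>. closure (\<omega> j) = \<Union>\<T>')"

definition polys_of_degree_le :: "nat \<Rightarrow> (real ^ 'n \<Rightarrow> real) set" where
  "polys_of_degree_le r =
    {q. \<exists>a. q = (\<lambda>x. \<Sum>\<alpha> | sum \<alpha> UNIV \<le> r. a \<alpha> * (\<Prod>j\<in>UNIV. (x $ j) ^ \<alpha> j))}"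

text \<open>
  Continuous piecewise polynomials of degree at most \<open>r\<close> on the part of the mesh covering \<open>closure S\<close>,
  as a subspace of \<open>H1 S\<close>, and those vanishing on the boundary, as a subspace of \<open>H10 S\<close>. Thus
  \<open>fe_space0 \<T> r \<Omega>\<close> is \<open>V\<^sub>h\<close> and \<open>fe_space0 \<T> r (\<omega> i)\<close> is \<open>V\<^sub>i\<^sub>,\<^sub>h\<^sub>,\<^sub>0\<close>.
\<close>

definition fe_space :: "(real ^ 'n) set set \<Rightarrow> nat \<Rightarrow> (real ^ 'n) set \<Rightarrow> (real ^ 'n \<Rightarrow> real) set" where
  "fe_space \<T> r S = {w \<in> H1 S. continuous_on (closure S) w \<and>
    (\<forall>\<tau>\<in>\<T>. \<tau> \<subseteq> closure S \<longrightarrow> (\<exists>q \<in> polys_of_degree_le r. \<forall>x\<in>\<tau>. w x = q x))}"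

definition fe_space0 :: "(real ^ 'n) set set \<Rightarrow> nat \<Rightarrow> (real ^ 'n) set \<Rightarrow> (real ^ 'n \<Rightarrow> real) set" where
  "fe_space0 \<T> r S = {w \<in> fe_space \<T> r S \<inter> H10 S. \<forall>x\<in>frontier S. w x = 0}"

section \<open>Variational problems\<close>

text \<open>\<open>w\<close> is the solution of the problem \<open>P\<close> on \<open>S\<close>, unique up to null sets.\<close>

definition unique_solution ::
    "(real ^ 'n) set \<Rightarrow> ((real ^ 'n \<Rightarrow> real) \<Rightarrow> bool) \<Rightarrow> (real ^ 'n \<Rightarrow> real) \<Rightarrow> bool" where
  "unique_solution S P w \<longleftrightarrow> P w \<and> (\<forall>w'. P w' \<longrightarrow> (AE x in lebesgue. x \<in> S \<longrightarrow> w' x = w x))"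

text \<open>
  The Dirichlet problem on \<open>S\<close> with trial space \<open>V\<close>, test space \<open>V0\<close> and boundary data taken from \<open>g\<close>.
  The boundary condition \<open>w = g\<close> on the boundary of \<open>S\<close> is \<open>w - g \<in> V0\<close>; for
  \<open>V0 = H10 S\<close> this is equality of traces, for \<open>V0 = fe_space0 \<T> r S\<close> it entails
  pointwise equality on \<open>frontier S\<close>.
\<close>

definition dirichlet_solution ::
    "(real ^ 'n \<Rightarrow> real ^ 'n ^ 'n) \<Rightarrow> (real ^ 'n \<Rightarrow> real ^ 'n) \<Rightarrow> (real ^ 'n \<Rightarrow> real) \<Rightarrow>
      (real ^ 'n \<Rightarrow> real) \<Rightarrow> (real ^ 'n) set \<Rightarrow> (real ^ 'n \<Rightarrow> real) set \<Rightarrow> (real ^ 'n \<Rightarrow> real) set \<Rightarrow>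
      (real ^ 'n \<Rightarrow> real) \<Rightarrow> (real ^ 'n \<Rightarrow> real) \<Rightarrow> bool" where
  "dirichlet_solution A b c f S V V0 g w \<longleftrightarrow>
    w \<in> V \<and> (\<lambda>x. w x - g x) \<in> V0 \<and> (\<forall>v\<in>V0. elliptic_form A b c S w v = L2_inner S f v)"

text \<open>
  In both iterations \<open>u (k * p + i)\<close> stands for the global iterate with superscript \<open>k + i/p\<close>, so that
  superscripts \<open>k + p/p\<close> and \<open>k + 1\<close> coincide, and \<open>ut k i\<close> for the local solution with superscript
  \<open>k + i/p\<close>. In the continuum case, functions are only determined up to null sets of the open
  subdomain; on its boundary the local solution and the previous iterate agree by the boundary
  condition, so the gluing prescribes the previous iterate there.
\<close>

definition schwarz_continuum ::
    "(real ^ 'n \<Rightarrow> real ^ 'n ^ 'n) \<Rightarrow> (real ^ 'n \<Rightarrow> real ^ 'n) \<Rightarrow> (real ^ 'n \<Rightarrow> real) \<Rightarrow>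
      (real ^ 'n \<Rightarrow> real) \<Rightarrow> (real ^ 'n) set \<Rightarrow> nat \<Rightarrow> (nat \<Rightarrow> (real ^ 'n) set) \<Rightarrow> nat \<Rightarrow>
      (nat \<Rightarrow> real ^ 'n \<Rightarrow> real) \<Rightarrow> (nat \<Rightarrow> nat \<Rightarrow> real ^ 'n \<Rightarrow> real) \<Rightarrow> bool" where
  "schwarz_continuum A b c f \<Omega> p \<omega> K u ut \<longleftrightarrow>
    (\<forall>k<K. \<forall>i\<in>{1..p}.
      unique_solution (\<omega> i)
        (dirichlet_solution A b c f (\<omega> i) (H1 (\<omega> i)) (H10 (\<omega> i)) (u (k * p + (i - 1)))) (ut k i) \<and>
      (AE x in lebesgue. x \<in> \<omega> i \<longrightarrow> u (k * p + i) x = ut k i x) \<and>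
      (AE x in lebesgue. x \<in> \<Omega> - \<omega> i \<longrightarrow> u (k * p + i) x = u (k * p + (i - 1)) x))"

definition schwarz_discrete ::
    "(real ^ 'n) set set \<Rightarrow> nat \<Rightarrow>
      (real ^ 'n \<Rightarrow> real ^ 'n ^ 'n) \<Rightarrow> (real ^ 'n \<Rightarrow> real ^ 'n) \<Rightarrow> (real ^ 'n \<Rightarrow> real) \<Rightarrow>
      (real ^ 'n \<Rightarrow> real) \<Rightarrow> (real ^ 'n) set \<Rightarrow> nat \<Rightarrow> (nat \<Rightarrow> (real ^ 'n) set) \<Rightarrow> nat \<Rightarrow>
      (nat \<Rightarrow> real ^ 'n \<Rightarrow> real) \<Rightarrow> (nat \<Rightarrow> nat \<Rightarrow> real ^ 'n \<Rightarrow> real) \<Rightarrow> bool" where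
  "schwarz_discrete \<T> r A b c f \<Omega> p \<omega> K U Ut \<longleftrightarrow>
    (\<forall>k<K. \<forall>i\<in>{1..p}.
      unique_solution (\<omega> i)
        (dirichlet_solution A b c f (\<omega> i) (fe_space \<T> r (\<omega> i)) (fe_space0 \<T> r (\<omega> i))
          (U (k * p + (i - 1)))) (Ut k i) \<and>
      U (k * p + i) \<in> fe_space0 \<T> r \<Omega> \<and>
      (\<forall>x\<in>closure (\<omega> i). U (k * p + i) x = Ut k i x) \<and>
      (\<forall>x\<in>\<Omega> - closure (\<omega> i). U (k * p + i) x = U (k * p + (i - 1)) x))"

section \<open>Adjoint problems\<close>

text \<open>Measurability makes the products \<open>\<eta> i * \<psi>\<close> elements of \<open>L2 \<Omega>\<close>.\<close>

definition partition_of_unity ::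
    "(real ^ 'n) set \<Rightarrow> nat \<Rightarrow> (nat \<Rightarrow> (real ^ 'n) set) \<Rightarrow> (nat \<Rightarrow> real ^ 'n \<Rightarrow> real) \<Rightarrow> bool" where
  "partition_of_unity \<Omega> p \<omega> \<eta> \<longleftrightarrow>
    (\<forall>i\<in>{1..p}. set_borel_measurable lebesgue \<Omega> (\<eta> i) \<and> (\<forall>x\<in>\<Omega>. 0 \<le> \<eta> i x) \<and>
      (\<forall>x\<in>\<Omega> - \<omega> i. \<eta> i x = 0)) \<and>
    (\<forall>x\<in>\<Omega>. (\<Sum>i=1..p. \<eta> i x) = 1)"

definition adjoint_data ::
    "(real ^ 'n \<Rightarrow> real ^ 'n ^ 'n) \<Rightarrow> (real ^ 'n \<Rightarrow> real ^ 'n) \<Rightarrow> (real ^ 'n \<Rightarrow> real) \<Rightarrow>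
      nat \<Rightarrow> (nat \<Rightarrow> (real ^ 'n) set) \<Rightarrow> nat \<Rightarrow> (nat \<Rightarrow> real ^ 'n \<Rightarrow> real) \<Rightarrow> (real ^ 'n \<Rightarrow> real) \<Rightarrow>
      (nat \<Rightarrow> nat \<Rightarrow> real ^ 'n \<Rightarrow> real) \<Rightarrow> nat \<Rightarrow> nat \<Rightarrow> (real ^ 'n \<Rightarrow> real) \<Rightarrow> real" where
  "adjoint_data A b c p \<omega> K \<eta> \<psi> \<phi> Q i v =
    (if Q = K - 1 then \<Sum>j=1..p. L2_inner (\<omega> i \<inter> \<omega> j) v (\<lambda>x. \<eta> j x * \<psi> x)
     else - (\<Sum>j=1..<i. elliptic_form A b c (\<omega> i \<inter> \<omega> j) v (\<phi> (Q + 1) j)))"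

definition schwarz_adjoint ::
    "(real ^ 'n \<Rightarrow> real ^ 'n ^ 'n) \<Rightarrow> (real ^ 'n \<Rightarrow> real ^ 'n) \<Rightarrow> (real ^ 'n \<Rightarrow> real) \<Rightarrow>
      nat \<Rightarrow> (nat \<Rightarrow> (real ^ 'n) set) \<Rightarrow> nat \<Rightarrow> (nat \<Rightarrow> real ^ 'n \<Rightarrow> real) \<Rightarrow> (real ^ 'n \<Rightarrow> real) \<Rightarrow>
      (nat \<Rightarrow> nat \<Rightarrow> real ^ 'n \<Rightarrow> real) \<Rightarrow> bool" where
  "schwarz_adjoint A b c p \<omega> K \<eta> \<psi> \<phi> \<longleftrightarrow>
    (\<forall>Q<K. \<forall>i\<in>{1..p}.
      unique_solution (\<omega> i)
        (\<lambda>w. w \<in> H10 (\<omega> i) \<and>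
          (\<forall>v\<in>H10 (\<omega> i). elliptic_form A b c (\<omega> i) v w =
            adjoint_data A b c p \<omega> K \<eta> \<psi> \<phi> Q i v
              - (\<Sum>j=i+1..p. elliptic_form A b c (\<omega> i \<inter> \<omega> j) v (\<phi> Q j))))
        (\<phi> Q i))"

end

theory Submission
  imports Defs "HOL-Real_Asymp.Real_Asymp"
begin

text \<open>
  The result is a duality argument. Both iterations, \<open>u\<close> and \<open>U\<close>, move from one global iterate to the
  next by adding the zero extension of a correction \<open>\<delta> k i \<in> H10 (\<omega> i)\<close>, and both start from the same
  function. So it suffices to understand one sequence \<open>w\<close> with corrections \<open>\<delta>\<close>, and to subtract the
  outcomes for \<open>u\<close> and \<open>U\<close> at the end.

  The adjoint problems are built so that each correction is paired with the adjoint functions of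
  its own and all later steps. Fix \<open>i\<close> and a test function \<open>v \<in> H10 (\<omega> i)\<close>, and write \<open>a\<^sub>i\<^sub>j\<close> for the form on
  \<open>\<omega> i \<inter> \<omega> j\<close>. For \<open>Q < K - 1\<close> the problem for \<open>\<phi> Q i\<close> says that the sum of \<open>a\<^sub>i\<^sub>j(v, \<phi>)\<close> over one full
  sweep, starting at the pair \<open>(Q, i)\<close> and ending just before \<open>(Q + 1, i)\<close>, vanishes; for
  \<open>Q = K - 1\<close> it says that the sum over the rest of the last sweep equals \<open>(v, \<psi>)\<close>, because the
  partition of unity reassembles \<open>\<psi>\<close>. Adding these identities, the sum of \<open>a\<^sub>i\<^sub>j(v, \<phi> k j)\<close> over
  \<^emph>\<open>all\<close> pairs \<open>(k, j)\<close> from \<open>(Q, i)\<close> onwards equals \<open>(v, \<psi>)\<close> (lemma \<open>adjoint_tail_sum\<close>). Taking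
  \<open>v = \<delta> Q i\<close>, summing over all \<open>(Q, i)\<close> and exchanging the order of summation, one collects for
  each \<open>(k, j)\<close> the corrections made up to that step, which add up to the iterate itself:
  \<open>(\<psi>, w (K p) - w 0)\<close> is the sum of \<open>a\<^sub>j(w (k p + j) - w 0, \<phi> k j)\<close> (lemma \<open>schwarz_duality\<close>).
  In the difference of the two instances the terms with \<open>w 0\<close> cancel,
  \<open>a\<^sub>j(u (k p + j), \<phi> k j) = l\<^sub>j(\<phi> k j)\<close> by the local problem, and what remains is the residual of the
  local discrete solution at \<open>\<phi> k j\<close>; the discrete local problem (Galerkin orthogonality) permits
  the subtraction of \<open>\<pi> j (\<phi> k j)\<close>.

  The analysis behind this is the statement that \<open>a\<^sub>i\<^sub>j(v, \<phi>)\<close>, computed with gradients on the overlap,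
  equals \<open>a\<^sub>j\<close> applied to the zero extension of \<open>v\<close> (lemma \<open>elliptic_form_zero_extension\<close>), and that
  the forms are additive. Since the gradient in the form is an arbitrarily chosen weak gradient,
  this rests on the uniqueness of weak gradients, hence on the fundamental lemma of the calculus of
  variations, which is proved from an explicit family of smooth bumps. That zero extensions of
  functions in \<open>H10\<close> are weakly differentiable follows from integration by parts for test functions
  and a passage to the limit.
\<close>

section \<open>Smooth functions with compact support\<close>

lemma partial_eqI: "(f has_derivative f') (at x) \<Longrightarrow> partial j f x = f' (axis j 1)"
  unfolding partial_def by (metis frechet_derivative_at)

lemma partial_mult:
  fixes f g :: "real ^ 'n \<Rightarrow> real"
  assumes "f differentiable (at x)" "g differentiable (at x)"
  shows "partial j (\<lambda>x. f x * g x) x = partial j f x * g x + f x * partial j g x"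
proof -
  have "((\<lambda>x. f x * g x) has_derivative
      (\<lambda>h. f x * frechet_derivative g (at x) h + frechet_derivative f (at x) h * g x)) (at x)"
    using assms by (intro has_derivative_mult) (simp_all add: frechet_derivative_works)
  from partial_eqI[OF this, of j] show ?thesis by (simp add: partial_def)
qed

lemma C_k_continuous: "C_k k f \<Longrightarrow> continuous_on UNIV f"
  by (cases k)
     (auto intro!: continuous_at_imp_continuous_on differentiable_imp_continuous_within)

lemma C_k_Suc_imp: "C_k (Suc k) f \<Longrightarrow> C_k k f"
proof (induction k arbitrary: f)
  case 0
  show ?case using C_k_continuous[OF 0] by simp
next
  case (Suc k)
  then show ?case by (metis C_k.simps(2))
qed

lemma C_k_const: "C_k k (\<lambda>x :: real ^ 'a. a)"
proof (induction k arbitrary: a)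
  case (Suc k)
  have "partial j (\<lambda>x. a) = (\<lambda>x. 0)" for j :: 'a
    by (rule ext, subst partial_eqI[OF has_derivative_const]) simp
  then show ?case using Suc by simp
qed simp

lemma C_k_add: "C_k k f \<Longrightarrow> C_k k g \<Longrightarrow> C_k k (\<lambda>x. f x + g x)"
proof (induction k arbitrary: f g)
  case (Suc k)
  have "partial j (\<lambda>x. f x + g x) = (\<lambda>x. partial j f x + partial j g x)" for j
  proof
    fix x
    have "((\<lambda>x. f x + g x) has_derivative
        (\<lambda>h. frechet_derivative f (at x) h + frechet_derivative g (at x) h)) (at x)"
      using Suc.prems by (intro has_derivative_add) (simp_all add: frechet_derivative_works)
    from partial_eqI[OF this, of j]
    show "partial j (\<lambda>x. f x + g x) x = partial j f x + partial j g x" by (simp add: partial_def)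
  qed
  then show ?case using Suc by auto
qed (auto intro: continuous_intros)

lemma C_k_mult: "C_k k f \<Longrightarrow> C_k k g \<Longrightarrow> C_k k (\<lambda>x. f x * g x)"
proof (induction k arbitrary: f g)
  case (Suc k)
  have "partial j (\<lambda>x. f x * g x) = (\<lambda>x. partial j f x * g x + f x * partial j g x)" for j
    by (rule ext, rule partial_mult) (use Suc.prems in auto)
  moreover have "C_k k (\<lambda>x. partial j f x * g x + f x * partial j g x)" for j
    using Suc.prems C_k_Suc_imp[OF Suc.prems(1)] C_k_Suc_imp[OF Suc.prems(2)]
    by (intro C_k_add Suc.IH) auto
  ultimately show ?case using Suc.prems by auto
qed (auto intro: continuous_intros)

lemma C_k_prod:
  assumes "finite I" "\<And>i. i \<in> I \<Longrightarrow> C_k k (f i)"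
  shows "C_k k (\<lambda>x. \<Prod>i\<in>I. f i x)"
  using assms by (induction I) (auto intro!: C_k_mult C_k_const)

text \<open>
  The classical function that is smooth but vanishes to infinite order at \<open>0\<close>, divided by \<open>t ^ m\<close>.
  The whole family is needed because it is closed under differentiation up to linear
  combinations, so that smoothness follows by induction over the order.
\<close>

definition flat :: "nat \<Rightarrow> real \<Rightarrow> real" where
  "flat m t = (if t > 0 then exp (- 1 / t) / t ^ m else 0)"

text \<open>
  Applied with \<open>m + 1\<close>, this is also the difference quotient of \<open>flat m\<close> at \<open>0\<close>.
\<close>

lemma flat_tendsto_0: "(flat m \<longlongrightarrow> 0) (at 0)"
proof -
  have "((\<lambda>t::real. exp (- 1 / t) / t ^ m) \<longlongrightarrow> 0) (at_right 0)"
    by real_asymp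
  then have "(flat m \<longlongrightarrow> 0) (at_right 0)"
    by (rule Lim_transform_eventually)
       (auto simp: flat_def eventually_at_filter)
  moreover have "(flat m \<longlongrightarrow> 0) (at_left 0)"
    by (rule Lim_transform_eventually[OF tendsto_const])
       (auto simp: flat_def eventually_at_filter)
  ultimately show ?thesis by (simp add: filterlim_split_at)
qed

lemma flat_has_derivative:
  "(flat m has_real_derivative flat (m + 2) t - real m * flat (m + 1) t) (at t)"
proof (cases t "0::real" rule: linorder_cases)
  case less
  have "((\<lambda>_. 0) has_real_derivative 0) (at t)" by simp
  then have "(flat m has_real_derivative 0) (at t)"
    by (rule has_field_derivative_transform_within_open[where S = "{..<0}"])
       (use less in \<open>auto simp: flat_def\<close>)
  then show ?thesis using less by (simp add: flat_def)
next
  case equal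
  have "((\<lambda>h. flat m h / h) \<longlongrightarrow> 0) (at 0)"
    by (rule Lim_transform_eventually[OF flat_tendsto_0[of "m + 1"]])
       (auto simp: flat_def eventually_at_filter)
  then show ?thesis using equal by (simp add: has_field_derivative_iff flat_def)
next
  case greater
  have "((\<lambda>t. exp (- 1 / t) / t ^ m) has_real_derivative
      (exp (- 1 / t) * (1 / t ^ 2)) / t ^ m - real m * (exp (- 1 / t) / t ^ (m + 1))) (at t)"
  proof -
    have "((\<lambda>t. - 1 / t) has_real_derivative 1 / t ^ 2) (at t)"
      using greater by (auto intro!: derivative_eq_intros simp: power2_eq_square)
    from DERIV_divide[OF DERIV_chain2[OF DERIV_exp this] DERIV_power[OF DERIV_ident, of m]] greater
    have "((\<lambda>t. exp (- 1 / t) / t ^ m) has_real_derivative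
      (exp (- 1 / t) * (1 / t ^ 2) * t ^ m - exp (- 1 / t) * (real m * (1 * t ^ (m - Suc 0)))) /
        (t ^ m * t ^ m)) (at t)" by simp
    then show ?thesis
      by (rule DERIV_cong) (use greater in \<open>cases m; simp add: field_simps\<close>)
  qed
  then have "(flat m has_real_derivative
      (exp (- 1 / t) * (1 / t ^ 2)) / t ^ m - real m * (exp (- 1 / t) / t ^ (m + 1))) (at t)"
    by (rule has_field_derivative_transform_within_open[where S = "{0<..}"])
       (use greater in \<open>auto simp: flat_def\<close>)
  then show ?thesis using greater by (simp add: flat_def power_add power2_eq_square mult_ac)
qed

lemma C_k_flat_affine:
  fixes i :: "'n::finite"
  shows "C_k k (\<lambda>x. flat m (\<alpha> * (x $ i) + \<beta>))"
proof (induction k arbitrary: m)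
  case 0
  have "continuous_on UNIV (flat m)"
    by (meson DERIV_isCont continuous_at_imp_continuous_on flat_has_derivative)
  then show ?case
    by (auto intro!: continuous_on_compose2[of UNIV "flat m"] continuous_intros)
next
  case (Suc k)
  have d: "((\<lambda>x. flat m (\<alpha> * (x $ i) + \<beta>)) has_derivative
      (\<lambda>h. (flat (m + 2) (\<alpha> * (x $ i) + \<beta>) - real m * flat (m + 1) (\<alpha> * (x $ i) + \<beta>)) * (\<alpha> * h $ i))) (at x)"
    for x :: "real ^ 'n"
  proof -
    have "((\<lambda>x. \<alpha> * (x $ i) + \<beta>) has_derivative (\<lambda>h. \<alpha> * h $ i)) (at x)"
      by (auto intro!: derivative_eq_intros bounded_linear.has_derivative[OF bounded_linear_vec_nth])
    from has_derivative_compose[OF this flat_has_derivative[unfolded has_field_derivative_def]]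
    show ?thesis by (simp add: mult_ac)
  qed
  have "partial j (\<lambda>x. flat m (\<alpha> * (x $ i) + \<beta>)) =
      (\<lambda>x. (flat (m + 2) (\<alpha> * (x $ i) + \<beta>) + (- real m) * flat (m + 1) (\<alpha> * (x $ i) + \<beta>)) * (\<alpha> * axis j 1 $ i))"
    for j
    by (rule ext, subst partial_eqI[OF d]) simp
  moreover have "C_k k (\<lambda>x::real^'n. (flat (m + 2) (\<alpha> * (x $ i) + \<beta>) + (- real m) * flat (m + 1) (\<alpha> * (x $ i) + \<beta>)) * (\<alpha> * axis j 1 $ i))" for j
    by (intro C_k_mult C_k_add C_k_const Suc.IH)
  ultimately show ?case using d by (auto simp: differentiable_def)
qed

text \<open>
  Since \<open>flat 0 (n * t)\<close> is the \<open>n\<close>-th root of \<open>flat 0 t\<close>, the bump for \<open>n\<close> is the \<open>n\<close>-th root of a fixed bump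
  that is positive exactly on the box. These roots stay smooth and tend to the
  indicator function of the box.
\<close>

definition box_bump :: "nat \<Rightarrow> real ^ 'n \<Rightarrow> real ^ 'n \<Rightarrow> real ^ 'n \<Rightarrow> real" where
  "box_bump n a b x =
    (\<Prod>i\<in>UNIV. flat 0 (real n * x $ i + - (real n * a $ i)) * flat 0 (- real n * x $ i + real n * b $ i))"

lemma flat_0_bounds: "0 \<le> flat 0 t" "flat 0 t \<le> 1"
  by (auto simp: flat_def)

lemma box_bump_bounds: "0 \<le> box_bump n a b x" "box_bump n a b x \<le> 1"
  unfolding box_bump_def
  by (auto intro!: prod_nonneg prod_le_1 mult_nonneg_nonneg mult_le_one flat_0_bounds)

lemma flat_scaled_tendsto: "(\<lambda>n. flat 0 (real n * t)) \<longlonglongrightarrow> (if t > 0 then 1 else 0)"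
proof (cases "t > 0")
  case True
  have "(\<lambda>n. exp (- 1 / (real n * t))) \<longlonglongrightarrow> 1" using True by real_asymp
  then have "(\<lambda>n. flat 0 (real n * t)) \<longlonglongrightarrow> 1"
    by (rule Lim_transform_eventually)
       (auto simp: flat_def True eventually_sequentially intro!: exI[of _ 1])
  then show ?thesis using True by simp
next
  case False
  then have "flat 0 (real n * t) = 0" for n
    by (auto simp: flat_def zero_less_mult_iff)
  then show ?thesis using False by simp
qed

lemma box_bump_tendsto: "(\<lambda>n. box_bump n a b x) \<longlonglongrightarrow> indicator (box a b) x"
proof -
  have "box_bump n a b x =
    (\<Prod>i\<in>UNIV. flat 0 (real n * (x $ i - a $ i)) * flat 0 (real n * (b $ i - x $ i)))" for n
    unfolding box_bump_def by (intro prod.cong) (auto simp: algebra_simps)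
  moreover have "(\<lambda>n. (\<Prod>i\<in>UNIV. flat 0 (real n * (x $ i - a $ i)) * flat 0 (real n * (b $ i - x $ i))))
    \<longlonglongrightarrow> (\<Prod>i\<in>UNIV. (if x $ i - a $ i > 0 then 1 else 0) * (if b $ i - x $ i > 0 then 1 else 0))"
    by (intro tendsto_prod tendsto_mult flat_scaled_tendsto)
  moreover have "(\<Prod>i\<in>UNIV. (if x $ i - a $ i > 0 then 1 else 0) * (if b $ i - x $ i > 0 then 1 else 0))
      = (indicator (box a b) x :: real)"
  proof (cases "x \<in> box a b")
    case True
    then show ?thesis by (simp add: mem_box_cart)
  next
    case False
    then obtain i where "\<not> (a $ i < x $ i \<and> x $ i < b $ i)" by (auto simp: mem_box_cart)
    then show ?thesis using False by (auto simp: indicator_def intro!: prod_zero bexI[of _ i])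
  qed
  ultimately show ?thesis by simp
qed

lemma box_bump_eq_0: "x \<notin> box a b \<Longrightarrow> box_bump n a b x = 0"
proof -
  assume "x \<notin> box a b"
  then obtain i where "\<not> (a $ i < x $ i \<and> x $ i < b $ i)" by (auto simp: mem_box_cart)
  then have "a $ i \<ge> x $ i \<or> x $ i \<ge> b $ i" by auto
  then have "real n * a $ i \<ge> real n * x $ i \<or> real n * x $ i \<ge> real n * b $ i"
    by (auto intro: mult_left_mono)
  then show ?thesis unfolding box_bump_def
    by (intro prod_zero bexI[of _ i]) (auto simp: flat_def)
qed

lemma box_bump_test:
  assumes "cbox a b \<subseteq> S"
  shows "box_bump n a b \<in> test_functions S"
proof -
  have "C_k k (box_bump n a b)" for k
    unfolding box_bump_def[abs_def]
    by (intro C_k_prod C_k_mult C_k_flat_affine) auto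
  moreover have "\<forall>x. x \<notin> cbox a b \<longrightarrow> box_bump n a b x = 0"
    using box_bump_eq_0 box_subset_cbox by blast
  ultimately show ?thesis
    using assms unfolding test_functions_def by (intro CollectI conjI allI exI[of _ "cbox a b"]) auto
qed

lemma partial_eq_0:
  assumes "closed C" "\<And>x. x \<notin> C \<Longrightarrow> v x = 0" "x \<notin> C"
  shows "partial j v x = 0"
proof -
  have "((\<lambda>_. 0) has_derivative (\<lambda>h. 0)) (at x)" by simp
  then have "(v has_derivative (\<lambda>h. 0)) (at x)"
    by (rule has_derivative_transform_within_open[of _ _ _ _ "- C"]) (use assms in auto)
  from partial_eqI[OF this] show ?thesis .
qed

lemma test_functionE:
  assumes "v \<in> test_functions S"
  obtains C where "compact C" "C \<subseteq> S" "\<And>x. x \<notin> C \<Longrightarrow> v x = 0" "\<And>j x. x \<notin> C \<Longrightarrow> partial j v x = 0"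
proof -
  obtain C where "compact C" "C \<subseteq> S" "\<And>x. x \<notin> C \<Longrightarrow> v x = 0"
    using assms unfolding test_functions_def by blast
  with that show thesis by (metis compact_imp_closed partial_eq_0)
qed

lemma test_function_C1:
  assumes "v \<in> test_functions S"
  shows "v differentiable (at x)" "continuous_on UNIV v" "continuous_on UNIV (partial j v)"
proof -
  have "C_k (Suc 0) v" "C_k 0 v" using assms by (auto simp: test_functions_def simp del: C_k.simps)
  then show "v differentiable (at x)" "continuous_on UNIV v" "continuous_on UNIV (partial j v)"
    by simp_all
qed

lemma test_functions_mono: "S \<subseteq> T \<Longrightarrow> test_functions S \<subseteq> test_functions T"
  unfolding test_functions_def by blast

lemma compact_support_bounded:
  fixes f :: "'a::metric_space \<Rightarrow> 'b::real_normed_vector"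
  assumes "continuous_on UNIV f" "compact C" "\<And>x. x \<notin> C \<Longrightarrow> f x = 0"
  obtains M where "M \<ge> 0" "\<And>x. norm (f x) \<le> M"
proof -
  have "compact (f ` C)"
    using assms by (meson compact_continuous_image continuous_on_subset subset_UNIV)
  then obtain M where M: "\<And>y. y \<in> f ` C \<Longrightarrow> norm y \<le> M"
    using compact_imp_bounded bounded_iff by metis
  have "norm (f x) \<le> max M 0" for x using M[of "f x"] assms(3)[of x] by (cases "x \<in> C") auto
  then show thesis using that[of "max M 0"] by auto
qed

section \<open>Integration by parts\<close>

lemma integral_translation:
  fixes g :: "'a::euclidean_space \<Rightarrow> real"
  assumes g: "integrable lborel g"
  shows "integrable lborel (\<lambda>x. g (x + t))" "(LINT x|lborel. g (x + t)) = (LINT x|lborel. g x)"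
proof -
  have "integrable (distr lborel borel ((+) t)) g" using g by (simp add: lborel_distr_plus)
  then have "integrable lborel (\<lambda>x. g (t + x))" by (rule integrable_distr[rotated]) auto
  then show "integrable lborel (\<lambda>x. g (x + t))" by (simp only: add.commute)
  have "(LINT x|lborel. g x) = (LINT x|distr lborel borel ((+) t). g x)" by (simp add: lborel_distr_plus)
  also have "\<dots> = (LINT x|lborel. g (t + x))" by (rule integral_distr) (use g in auto)
  finally show "(LINT x|lborel. g (x + t)) = (LINT x|lborel. g x)" by (simp only: add.commute)
qed

text \<open>
  By translation invariance the difference quotients of \<open>g\<close> in direction \<open>j\<close> have integral \<open>0\<close>. They
  are bounded uniformly by the mean value theorem and live in a common compact set, so dominated
  convergence carries this over to the derivative.
\<close>

lemma integral_partial_eq_0: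
  fixes g :: "real ^ 'n \<Rightarrow> real"
  assumes diff: "\<And>x. g differentiable (at x)" and cont: "continuous_on UNIV (partial j g)"
    and C: "compact C" "\<And>x. x \<notin> C \<Longrightarrow> g x = 0"
  shows "(LINT x|lborel. partial j g x) = 0"
proof -
  define e :: "real ^ 'n" where "e = axis j 1"
  define q where "q n x = real (Suc n) * (g (x + (1 / real (Suc n)) *\<^sub>R e) - g x)" for n x
  have "continuous_on UNIV g"
    using diff by (auto intro!: continuous_at_imp_continuous_on differentiable_imp_continuous_within)
  then have [measurable]: "g \<in> borel_measurable borel" "partial j g \<in> borel_measurable borel"
    using cont by (auto intro: borel_measurable_continuous_onI)
  obtain M where M: "M \<ge> 0" "\<And>x. norm (partial j g x) \<le> M"
    using compact_support_bounded[OF cont C(1) partial_eq_0[OF compact_imp_closed[OF C(1)] C(2)]] by metis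
  have der: "((\<lambda>t. g (x + t *\<^sub>R e)) has_real_derivative partial j g (x + t *\<^sub>R e)) (at t)" for x t
  proof -
    have "((\<lambda>t. x + t *\<^sub>R e) has_derivative (\<lambda>h. h *\<^sub>R e)) (at t)"
      by (auto intro!: derivative_eq_intros)
    from has_derivative_compose[OF this] diff[of "x + t *\<^sub>R e"]
    have d: "((\<lambda>t. g (x + t *\<^sub>R e)) has_derivative (\<lambda>h. frechet_derivative g (at (x + t *\<^sub>R e)) (h *\<^sub>R e))) (at t)"
      by (simp add: frechet_derivative_works)
    have "frechet_derivative g (at (x + t *\<^sub>R e)) (h *\<^sub>R e) = partial j g (x + t *\<^sub>R e) * h" for h
      using linear_frechet_derivative[OF diff] by (simp add: linear_scale partial_def e_def)
    with d show ?thesis by (simp add: has_field_derivative_def)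
  qed
  have norm_e: "norm e = 1" by (simp add: e_def)
  \<comment> \<open>Contains the support of every difference quotient, whose step is at most \<open>1\<close>.\<close>
  define C' where "C' = {x + y | x y. x \<in> C \<and> y \<in> cball 0 1}"
  have C': "compact C'" unfolding C'_def by (intro compact_sums C) simp
  have C'I: "z \<in> C'" if "z + y \<in> C" "norm y \<le> 1" for z y
    unfolding C'_def using that by (intro CollectI exI[of _ "z + y"] exI[of _ "- y"]) simp
  have bound: "norm (q n x) \<le> indicator C' x *\<^sub>R M" for n x
  proof -
    let ?h = "1 / real (Suc n)"
    have h: "0 < ?h" "?h \<le> 1" by auto
    obtain s where s: "g (x + ?h *\<^sub>R e) - g (x + 0 *\<^sub>R e) = (?h - 0) * partial j g (x + s *\<^sub>R e)"
      using MVT2[of 0 ?h "\<lambda>t. g (x + t *\<^sub>R e)", OF h(1) der] by blast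
    have "q n x = partial j g (x + s *\<^sub>R e)" unfolding q_def using s by simp
    then have le: "norm (q n x) \<le> M" using M by simp
    show ?thesis
    proof (cases "x \<in> C'")
      case False
      have "norm (?h *\<^sub>R e) \<le> 1" using h by (simp add: norm_e)
      then have "x \<notin> C" "x + ?h *\<^sub>R e \<notin> C" using C'I[of x 0] C'I[of x "?h *\<^sub>R e"] False by auto
      then have "q n x = 0" unfolding q_def using C(2) by simp
      then show ?thesis by (simp add: M)
    qed (use le in simp)
  qed
  have "(\<lambda>n. LINT x|lborel. q n x) \<longlonglongrightarrow> (LINT x|lborel. partial j g x)"
  proof (rule integral_dominated_convergence[where w = "\<lambda>x. indicator C' x *\<^sub>R M"])
    show "integrable lborel (\<lambda>x. indicator C' x *\<^sub>R M)"
      by (rule borel_integrable_compact[OF C' continuous_on_const])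
    show "AE x in lborel. (\<lambda>n. q n x) \<longlonglongrightarrow> partial j g x"
    proof (rule AE_I2)
      fix x
      have "((\<lambda>h. (g (x + h *\<^sub>R e) - g x) / h) \<longlongrightarrow> partial j g x) (at 0)"
        using der[of x 0] by (simp add: has_field_derivative_iff)
      moreover have "filterlim (\<lambda>n. 1 / real (Suc n)) (at 0) sequentially"
        unfolding filterlim_at using LIMSEQ_Suc[OF lim_1_over_n] by auto
      ultimately have "(\<lambda>n. (g (x + (1 / real (Suc n)) *\<^sub>R e) - g x) / (1 / real (Suc n))) \<longlonglongrightarrow> partial j g x"
        by (rule filterlim_compose[where g = "\<lambda>h. (g (x + h *\<^sub>R e) - g x) / h" and f = "\<lambda>n. 1 / real (Suc n)"])
      then show "(\<lambda>n. q n x) \<longlonglongrightarrow> partial j g x" by (simp add: q_def mult.commute)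
    qed
  qed (use bound in \<open>auto simp: q_def[abs_def]\<close>)
  moreover have "(LINT x|lborel. q n x) = 0" for n
  proof -
    have g: "integrable lborel g"
    proof -
      obtain B where "B \<ge> 0" "\<And>x. norm (g x) \<le> B"
        using compact_support_bounded[OF \<open>continuous_on UNIV g\<close> C] by metis
      then have "norm (g x) \<le> norm (indicator C x *\<^sub>R B)" for x
        using C(2)[of x] by (cases "x \<in> C") simp_all
      then show ?thesis
        by (intro Bochner_Integration.integrable_bound[OF borel_integrable_compact[OF C(1) continuous_on_const[of C B]]])
          auto
    qed
    define t where "t = (1 / real (Suc n)) *\<^sub>R e"
    have "integrable lborel (\<lambda>x. g (x + t))" "(LINT x|lborel. g (x + t)) = (LINT x|lborel. g x)"
      using integral_translation[OF g] by auto
    moreover have "q n = (\<lambda>x. real (Suc n) * (g (x + t) - g x))" by (simp add: q_def[abs_def] t_def)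
    ultimately show ?thesis using g by simp
  qed
  ultimately show ?thesis by (simp add: LIMSEQ_const_iff)
qed

section \<open>Square integrable functions\<close>

text \<open>
  The Lebesgue measure is complete, so functions that agree almost everywhere are measurable together;
  if they are not measurable, both integrals are \<open>0\<close> by convention.
\<close>

lemma set_integral_cong_AE_lebesgue:
  fixes f g :: "real ^ 'n \<Rightarrow> real"
  assumes "AE x in lebesgue. x \<in> S \<longrightarrow> f x = g x"
  shows "(LINT x:S|lebesgue. f x) = (LINT x:S|lebesgue. g x)"
proof -
  let ?f = "\<lambda>x. indicator S x *\<^sub>R f x" and ?g = "\<lambda>x. indicator S x *\<^sub>R g x"
  have fg: "AE x in lebesgue. ?f x = ?g x"
    using assms by eventually_elim (auto simp: indicator_def)
  then have gf: "AE x in lebesgue. ?g x = ?f x" by eventually_elim (rule sym)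
  show ?thesis
  proof (cases "?f \<in> borel_measurable lebesgue")
    case True
    then show ?thesis unfolding set_lebesgue_integral_def
      by (intro integral_cong_AE fg borel_measurable_AE[OF True fg])
  next
    case False
    then have "\<not> integrable lebesgue ?f" "\<not> integrable lebesgue ?g"
      using borel_measurable_AE[OF _ gf] by auto
    then show ?thesis unfolding set_lebesgue_integral_def by (simp add: not_integrable_integral_eq)
  qed
qed

lemma L2_iff:
  "u \<in> L2 S \<longleftrightarrow> (\<lambda>x. indicator S x *\<^sub>R u x) \<in> borel_measurable lebesgue \<and>
     integrable lebesgue (\<lambda>x. (norm (indicator S x *\<^sub>R u x))\<^sup>2)"
proof -
  have "(\<lambda>x. indicator S x *\<^sub>R (norm (u x))\<^sup>2) = (\<lambda>x. (norm (indicator S x *\<^sub>R u x))\<^sup>2)"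
    by (auto simp: indicator_def)
  then show ?thesis
    by (simp add: L2_def set_borel_measurable_def set_integrable_def)
qed

lemma L2_cong_AE:
  assumes u: "u \<in> L2 S" and ae: "AE x in lebesgue. x \<in> S \<longrightarrow> u x = v x"
  shows "v \<in> L2 S"
proof -
  let ?u = "\<lambda>x. indicator S x *\<^sub>R u x" and ?v = "\<lambda>x. indicator S x *\<^sub>R v x"
  have uv: "AE x in lebesgue. ?u x = ?v x"
    using ae by eventually_elim (auto simp: indicator_def)
  have m: "?v \<in> borel_measurable lebesgue"
    using borel_measurable_AE[OF _ uv] u by (simp add: L2_iff)
  moreover have "integrable lebesgue (\<lambda>x. (norm (?v x))\<^sup>2)"
  proof (rule integrable_cong_AE_imp)
    show "integrable lebesgue (\<lambda>x. (norm (?u x))\<^sup>2)" using u by (simp add: L2_iff)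
    show "AE x in lebesgue. (norm (?u x))\<^sup>2 = (norm (?v x))\<^sup>2"
      using uv by eventually_elim (simp only:)
  qed (use m in measurable)
  ultimately show ?thesis by (simp add: L2_iff)
qed

lemma L2I_bound:
  fixes u :: "real ^ 'n \<Rightarrow> 'b::euclidean_space" and w :: "real ^ 'n \<Rightarrow> 'c::euclidean_space"
  assumes w: "set_borel_measurable lebesgue S w" and u: "u \<in> L2 S"
    and le: "\<And>x. x \<in> S \<Longrightarrow> norm (w x) \<le> M * norm (u x)"
  shows "w \<in> L2 S"
proof -
  have m[measurable]: "(\<lambda>x. indicator S x *\<^sub>R w x) \<in> borel_measurable lebesgue"
    using w by (simp add: set_borel_measurable_def)
  have "integrable lebesgue (\<lambda>x. (norm (indicator S x *\<^sub>R w x))\<^sup>2)"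
  proof (rule Bochner_Integration.integrable_bound)
    show "integrable lebesgue (\<lambda>x. M\<^sup>2 * (norm (indicator S x *\<^sub>R u x))\<^sup>2)"
      using u by (simp add: L2_iff)
    have "(norm (w x))\<^sup>2 \<le> M\<^sup>2 * (norm (u x))\<^sup>2" if "x \<in> S" for x
      using power_mono[OF le[OF that], of 2] by (simp add: power_mult_distrib)
    then show "AE x in lebesgue. norm ((norm (indicator S x *\<^sub>R w x))\<^sup>2)
        \<le> norm (M\<^sup>2 * (norm (indicator S x *\<^sub>R u x))\<^sup>2)"
      by (intro AE_I2) (simp add: indicator_def)
  qed measurable
  with m show ?thesis by (simp add: L2_iff)
qed

lemma L2_add:
  assumes u: "u \<in> L2 S" and v: "v \<in> L2 S"
  shows "(\<lambda>x. u x + v x) \<in> L2 S"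
proof -
  let ?u = "\<lambda>x. indicator S x *\<^sub>R u x" and ?v = "\<lambda>x. indicator S x *\<^sub>R v x"
  have [measurable]: "?u \<in> borel_measurable lebesgue" "?v \<in> borel_measurable lebesgue"
    using u v by (auto simp: L2_iff)
  have eq: "(\<lambda>x. indicator S x *\<^sub>R (u x + v x)) = (\<lambda>x. ?u x + ?v x)"
    by (simp add: scaleR_add_right)
  have "integrable lebesgue (\<lambda>x. (norm (?u x + ?v x))\<^sup>2)"
  proof (rule Bochner_Integration.integrable_bound)
    show "integrable lebesgue (\<lambda>x. 2 * (norm (?u x))\<^sup>2 + 2 * (norm (?v x))\<^sup>2)"
      using u v by (simp add: L2_iff)
    have le: "(norm (a + b))\<^sup>2 \<le> 2 * (norm a)\<^sup>2 + 2 * (norm b)\<^sup>2" for a b :: 'b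
      using power_mono[OF norm_triangle_ineq[of a b], of 2] sum_squares_bound[of "norm a" "norm b"]
      by (simp add: power2_sum)
    have "norm ((norm (a + b))\<^sup>2) \<le> norm (2 * (norm a)\<^sup>2 + 2 * (norm b)\<^sup>2)" for a b :: 'b
      using le[of a b] by simp
    then show "AE x in lebesgue. norm ((norm (?u x + ?v x))\<^sup>2)
        \<le> norm (2 * (norm (?u x))\<^sup>2 + 2 * (norm (?v x))\<^sup>2)"
      by (intro AE_I2)
  qed measurable
  moreover have "(\<lambda>x. ?u x + ?v x) \<in> borel_measurable lebesgue" by measurable
  ultimately show ?thesis unfolding L2_iff eq fun_cong[OF eq] by (intro conjI)
qed

lemma L2_uminus:
  assumes "u \<in> L2 S"
  shows "(\<lambda>x. - u x) \<in> L2 S"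
proof (rule L2I_bound[OF _ assms, of _ 1])
  have "(\<lambda>x. - (indicator S x *\<^sub>R u x)) \<in> borel_measurable lebesgue"
    using assms by (intro borel_measurable_uminus) (simp add: L2_iff)
  then show "set_borel_measurable lebesgue S (\<lambda>x. - u x)" by (simp add: set_borel_measurable_def)
qed simp

lemma L2_diff:
  assumes "u \<in> L2 S" "v \<in> L2 S"
  shows "(\<lambda>x. u x - v x) \<in> L2 S"
  using L2_add[OF assms(1) L2_uminus[OF assms(2)]] by simp

lemma L2_subset:
  assumes u: "u \<in> L2 S" and T: "T \<subseteq> S" "T \<in> sets lebesgue"
  shows "u \<in> L2 T"
proof -
  let ?u = "\<lambda>x. indicator S x *\<^sub>R u x"
  have [measurable]: "?u \<in> borel_measurable lebesgue" using u by (auto simp: L2_iff)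
  have eq: "(\<lambda>x. indicator T x *\<^sub>R u x) = (\<lambda>x. indicator T x *\<^sub>R ?u x)"
    using T by (auto simp: indicator_def fun_eq_iff)
  have m: "(\<lambda>x. indicator T x *\<^sub>R ?u x) \<in> borel_measurable lebesgue"
    using T by measurable
  have "integrable lebesgue (\<lambda>x. (norm (indicator T x *\<^sub>R ?u x))\<^sup>2)"
  proof (rule Bochner_Integration.integrable_bound)
    show "integrable lebesgue (\<lambda>x. (norm (?u x))\<^sup>2)" using u by (simp add: L2_iff)
    show "AE x in lebesgue. norm ((norm (indicator T x *\<^sub>R ?u x))\<^sup>2) \<le> norm ((norm (?u x))\<^sup>2)"
      by (intro AE_I2) (simp add: indicator_def)
  qed (use m in measurable)
  with m show ?thesis unfolding L2_iff eq fun_cong[OF eq] by (intro conjI)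
qed

lemma L2_mult_integrable:
  fixes u v :: "real ^ 'n \<Rightarrow> real"
  assumes u: "u \<in> L2 S" and v: "v \<in> L2 S"
  shows "set_integrable lebesgue S (\<lambda>x. u x * v x)"
proof -
  let ?u = "\<lambda>x. indicator S x *\<^sub>R u x" and ?v = "\<lambda>x. indicator S x *\<^sub>R v x"
  have [measurable]: "?u \<in> borel_measurable lebesgue" "?v \<in> borel_measurable lebesgue"
    using u v by (auto simp: L2_iff)
  have eq: "(\<lambda>x. indicator S x *\<^sub>R (u x * v x)) = (\<lambda>x. ?u x * ?v x)"
    by (auto simp: indicator_def fun_eq_iff)
  have "integrable lebesgue (\<lambda>x. ?u x * ?v x)"
  proof (rule Bochner_Integration.integrable_bound)
    show "integrable lebesgue (\<lambda>x. (norm (?u x))\<^sup>2 + (norm (?v x))\<^sup>2)"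
      using u v by (simp add: L2_iff)
    have "\<bar>a * b\<bar> \<le> a\<^sup>2 + b\<^sup>2" for a b :: real
    proof -
      have "2 * \<bar>a * b\<bar> \<le> a\<^sup>2 + b\<^sup>2"
        using sum_squares_bound[of "\<bar>a\<bar>" "\<bar>b\<bar>"] by (simp add: abs_mult mult.assoc)
      then show ?thesis using abs_ge_zero[of "a * b"] by linarith
    qed
    then show "AE x in lebesgue. norm (?u x * ?v x) \<le> norm ((norm (?u x))\<^sup>2 + (norm (?v x))\<^sup>2)"
      by (intro AE_I2) simp
  qed measurable
  then show ?thesis unfolding set_integrable_def eq .
qed

lemma L2_component:
  fixes G :: "real ^ 'n \<Rightarrow> real ^ 'm"
  assumes "G \<in> L2 S"
  shows "(\<lambda>x. G x $ j) \<in> L2 S"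
proof (rule L2I_bound[OF _ assms, of _ 1])
  have "(\<lambda>x. indicator S x *\<^sub>R G x) \<in> borel_measurable lebesgue" using assms by (simp add: L2_iff)
  then have "(\<lambda>x. (indicator S x *\<^sub>R G x) \<bullet> axis j 1) \<in> borel_measurable lebesgue" by measurable
  then show "set_borel_measurable lebesgue S (\<lambda>x. G x $ j)"
    by (simp add: set_borel_measurable_def inner_axis)
qed (simp add: component_le_norm_cart)

lemma compact_support_L2:
  fixes f :: "real ^ 'n \<Rightarrow> 'b::euclidean_space"
  assumes f: "continuous_on UNIV f" and C: "compact C" "\<And>x. x \<notin> C \<Longrightarrow> f x = 0"
    and S: "S \<in> sets lebesgue"
  shows "f \<in> L2 S"
proof -
  have m: "f \<in> borel_measurable lebesgue"
    using borel_measurable_continuous_onI[OF f] by (intro measurable_completion) simp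
  have f2: "continuous_on UNIV (\<lambda>x. (norm (f x))\<^sup>2)" by (intro continuous_intros f)
  have "integrable lborel (\<lambda>x. indicator C x *\<^sub>R (norm (f x))\<^sup>2)"
    by (rule borel_integrable_compact[OF C(1) continuous_on_subset[OF f2]]) simp
  moreover have eq: "(\<lambda>x. indicator C x *\<^sub>R (norm (f x))\<^sup>2) = (\<lambda>x. (norm (f x))\<^sup>2)"
    using C(2) by (auto simp: indicator_def fun_eq_iff)
  ultimately have "integrable lebesgue (\<lambda>x. (norm (f x))\<^sup>2)"
    using integrable_completion[of "\<lambda>x. (norm (f x))\<^sup>2" lborel] borel_measurable_continuous_onI[OF f2] by simp
  with m have "f \<in> L2 UNIV" by (simp add: L2_iff)
  from L2_subset[OF this _ S] show ?thesis by simp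
qed

section \<open>The fundamental lemma of the calculus of variations\<close>

text \<open>
  The Borel sets over which \<open>h\<close> integrates to \<open>0\<close> form a Dynkin system. As boxes generate the Borel
  sets and are closed under intersection, it contains all of them. The argument runs on a Borel
  function that agrees with \<open>h\<close> almost everywhere.
\<close>

lemma AE_eq_0_of_box_integrals:
  fixes h :: "real ^ 'n \<Rightarrow> real"
  assumes h: "integrable lebesgue h" "(LINT x|lebesgue. h x) = 0"
    and box: "\<And>a b. (LINT x:box a b|lebesgue. h x) = 0"
  shows "AE x in lebesgue. h x = 0"
proof -
  obtain g where g[measurable]: "g \<in> borel_measurable lborel" and hg: "AE x in lborel. h x = g x"
    using completion_ex_borel_measurable_real[of h lborel] h(1) by auto
  have hg': "AE x in lebesgue. h x = g x" using hg by (rule AE_completion)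
  have gm: "g \<in> borel_measurable lebesgue" using g by (rule measurable_completion)
  have "integrable lebesgue g" using integrable_cong_AE_imp[OF h(1) gm] hg' by auto
  then have gi: "integrable lborel g" using integrable_completion[OF g] by simp
  have set: "(LINT x:A|lborel. g x) = (LINT x:A|lebesgue. h x)" if A: "A \<in> sets lborel" for A
  proof -
    have "(LINT x:A|lborel. g x) = (LINT x:A|lebesgue. g x)"
      unfolding set_lebesgue_integral_def 
      using A g by (intro integral_completion[symmetric] borel_measurable_scaleR borel_measurable_indicator)
    also have "\<dots> = (LINT x:A|lebesgue. h x)"
      by (rule set_integral_cong_AE_lebesgue) (use hg' in \<open>eventually_elim, simp\<close>)
    finally show ?thesis .
  qed
  have gset: "set_integrable lborel A g" if "A \<in> sets lborel" for A
    unfolding set_integrable_def by (rule integrable_mult_indicator[OF that gi])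
  have UNIV0: "(LINT x:UNIV|lborel. g x) = 0"
    using h(2) set[of UNIV] by (simp add: set_lebesgue_integral_def)
  have zero: "(LINT x:A|lborel. g x) = 0" if "A \<in> sets borel" for A
  proof -
    let ?G = "range (\<lambda>(a, b). box a b :: (real ^ 'n) set)"
    have sigma: "sigma_sets UNIV ?G = sets borel"
      by (simp add: borel_eq_box)
    have "Int_stable ?G" by (auto simp: Int_stable_def box_Int_box)
    moreover have "?G \<subseteq> Pow UNIV" by simp
    moreover have "A \<in> sigma_sets UNIV ?G" using that sigma by simp
    ultimately show ?thesis
    proof (induction rule: sigma_sets_induct_disjoint)
      case (basic A)
      then show ?case using box set by auto
    next
      case empty
      show ?case by (simp add: set_lebesgue_integral_def)
    next
      case (compl A)
      then have "A \<in> sets borel" using sigma by simp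
      then have "(LINT x:A \<union> (UNIV - A)|lborel. g x) = (LINT x:A|lborel. g x) + (LINT x:UNIV - A|lborel. g x)"
        by (intro set_integral_Un gset) auto
      then show ?case using compl UNIV0 by simp
    next
      case (union A)
      then have A: "A i \<in> sets lborel" for i using sigma by auto
      then have "(\<Union>i. A i) \<in> sets lborel" by (intro sets.countable_UN) auto
      note gset[OF this]
      then have "(LINT x:(\<Union>i. A i)|lborel. g x) = (\<Sum>i. (LINT x:A i|lborel. g x))"
        using union(1) A by (intro lebesgue_integral_countable_add) (auto simp: disjoint_family_on_def)
      then show ?case using union by simp
    qed
  qed
  have "AE x in lborel. g x = 0"
    using zero by (intro density_unique_real gi) (auto simp: set_lebesgue_integral_def)
  then show ?thesis using hg' AE_completion[of "\<lambda>x. g x = 0" lborel] by auto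
qed

text \<open>
  Testing with the bumps of a box whose closure lies in \<open>S\<close> and letting them tend to the indicator
  function shows that \<open>g\<close> integrates to \<open>0\<close> over all such boxes; and \<open>S\<close> is a countable union of closed boxes.
\<close>

lemma fundamental_lemma:
  fixes g :: "real ^ 'n \<Rightarrow> real"
  assumes S: "open S" and g: "g \<in> L2 S"
    and zero: "\<And>v. v \<in> test_functions S \<Longrightarrow> (LINT x:S|lebesgue. g x * v x) = 0"
  shows "AE x in lebesgue. x \<in> S \<longrightarrow> g x = 0"
proof -
  have L2I: "(indicator T :: _ \<Rightarrow> real) \<in> L2 S" if "bounded T" "T \<in> sets lebesgue" for T :: "(real ^ 'n) set"
  proof -
    have "integrable lebesgue (indicator (T \<inter> S) :: _ \<Rightarrow> real)"
      using that S by (intro lmeasurable_iff_integrable[THEN iffD1] bounded_set_imp_lmeasurable)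
        (auto intro: bounded_Int)
    moreover have "(\<lambda>x. indicator S x *\<^sub>R indicator T x) = (indicator (T \<inter> S) :: _ \<Rightarrow> real)"
      "(\<lambda>x. (norm (indicator S x *\<^sub>R indicator T x :: real))\<^sup>2) = (indicator (T \<inter> S) :: _ \<Rightarrow> real)"
      by (auto simp: indicator_def fun_eq_iff)
    ultimately show ?thesis
      unfolding L2_iff by (intro conjI) (simp_all only: borel_measurable_integrable)
  qed
  \<comment> \<open>The bumps are bounded by the indicator function of the box, which dominates the convergence.\<close>
  have box: "(LINT x:box a b|lebesgue. g x) = 0" if ab: "cbox a b \<subseteq> S" for a b
  proof -
    have bS: "box a b \<subseteq> S" using ab box_subset_cbox by blast
    have gm[measurable]: "(\<lambda>x. indicator S x *\<^sub>R g x) \<in> borel_measurable lebesgue"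
      using g by (simp add: L2_iff)
    have bm: "box_bump n a b \<in> borel_measurable lebesgue" for n
      using test_function_C1(2)[OF box_bump_test[OF ab]]
      by (intro measurable_completion) (auto intro: borel_measurable_continuous_onI)
    have "(\<lambda>n. LINT x|lebesgue. indicator S x *\<^sub>R (g x * box_bump n a b x))
        \<longlonglongrightarrow> (LINT x|lebesgue. indicator S x *\<^sub>R (g x * indicator (box a b) x))"
    proof (rule integral_dominated_convergence[where w = "\<lambda>x. norm (indicator S x *\<^sub>R (g x * indicator (box a b) x))"])
      have "set_integrable lebesgue S (\<lambda>x. g x * indicator (box a b) x)"
        by (intro L2_mult_integrable g L2I) (auto simp: bounded_box)
      then show "integrable lebesgue (\<lambda>x. norm (indicator S x *\<^sub>R (g x * indicator (box a b) x)))"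
        unfolding set_integrable_def by (rule integrable_norm)
      then show "(\<lambda>x. indicator S x *\<^sub>R (g x * indicator (box a b) x)) \<in> borel_measurable lebesgue"
        using \<open>set_integrable lebesgue S _\<close> by (simp add: set_integrable_def)
      have "(\<lambda>x. (indicator S x *\<^sub>R g x) * box_bump n a b x) \<in> borel_measurable lebesgue" for n
        using bm gm by (rule borel_measurable_times[rotated])
      then show "(\<lambda>x. indicator S x *\<^sub>R (g x * box_bump n a b x)) \<in> borel_measurable lebesgue" for n
        by (simp add: mult.assoc)
      show "AE x in lebesgue. (\<lambda>n. indicator S x *\<^sub>R (g x * box_bump n a b x))
          \<longlonglongrightarrow> indicator S x *\<^sub>R (g x * indicator (box a b) x)"
        by (intro AE_I2 tendsto_intros box_bump_tendsto)
      show "AE x in lebesgue. norm (indicator S x *\<^sub>R (g x * box_bump n a b x))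
          \<le> norm (indicator S x *\<^sub>R (g x * indicator (box a b) x))" for n
      proof (rule AE_I2)
        fix x
        have "\<bar>box_bump n a b x\<bar> \<le> indicator (box a b) x"
          using box_bump_eq_0[of x a b n] box_bump_bounds[of n a b x] by (cases "x \<in> box a b") auto
        then show "norm (indicator S x *\<^sub>R (g x * box_bump n a b x))
          \<le> norm (indicator S x *\<^sub>R (g x * indicator (box a b) x))"
          by (simp add: abs_mult mult_left_mono)
      qed
    qed
    moreover have "(LINT x|lebesgue. indicator S x *\<^sub>R (g x * box_bump n a b x)) = 0" for n
      using zero[OF box_bump_test[OF ab, of n]] by (simp add: set_lebesgue_integral_def)
    ultimately have "(LINT x|lebesgue. indicator S x *\<^sub>R (g x * indicator (box a b) x)) = 0"
      by (simp add: LIMSEQ_const_iff)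
    moreover have "(\<lambda>x. indicator S x *\<^sub>R (g x * indicator (box a b) x)) = (\<lambda>x. indicator (box a b) x *\<^sub>R g x)"
      using bS by (auto simp: indicator_def fun_eq_iff)
    ultimately show ?thesis by (simp add: set_lebesgue_integral_def)
  qed
  have cbox: "AE x in lebesgue. x \<in> cbox a b \<longrightarrow> g x = 0" if ab: "cbox a b \<subseteq> S" for a b
  proof -
    define h where "h x = indicator (box a b) x *\<^sub>R g x" for x
    have bS: "box a b \<subseteq> S" using ab box_subset_cbox by blast
    have h_eq: "h = (\<lambda>x. indicator S x *\<^sub>R (g x * indicator (box a b) x))"
      using bS by (auto simp: indicator_def fun_eq_iff h_def)
    have "AE x in lebesgue. h x = 0"
    proof (rule AE_eq_0_of_box_integrals)
      show "integrable lebesgue h"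
        using L2_mult_integrable[OF g L2I[of "box a b"]] unfolding h_eq set_integrable_def by (simp add: bounded_box)
      show "(LINT x|lebesgue. h x) = 0"
        using box[OF ab] by (simp add: h_def[abs_def] set_lebesgue_integral_def)
      fix c d
      \<comment> \<open>If \<open>box a' b'\<close> is empty, \<open>cbox a' b'\<close> need not lie in \<open>S\<close>; hence the case split below.\<close>
      obtain a' b' where ab': "box a b \<inter> box c d = box a' b'" by (rule that[OF box_Int_box])
      have "(LINT x:box c d|lebesgue. h x) = (LINT x:box a' b'|lebesgue. g x)"
        unfolding set_lebesgue_integral_def ab'[symmetric]
        by (intro Bochner_Integration.integral_cong) (auto simp: h_def indicator_def)
      also have "\<dots> = 0"
      proof (cases "box a' b' = {}")
        case True
        then show ?thesis by (simp add: set_lebesgue_integral_def)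
      next
        case False
        then have "cbox a' b' = closure (box a' b')" by (simp add: closure_box)
        also have "\<dots> \<subseteq> cbox a b"
          unfolding ab'[symmetric] using box_subset_cbox by (intro closure_minimal) blast+
        finally show ?thesis using ab by (intro box) blast
      qed
      finally show "(LINT x:box c d|lebesgue. h x) = 0" .
    qed
    moreover have "AE x in lebesgue. x \<notin> cbox a b - box a b"
      using negligible_frontier_interval[of a b] by (intro AE_not_in) (simp add: negligible_iff_null_sets)
    ultimately show ?thesis by eventually_elim (auto simp: h_def indicator_def split: if_splits)
  qed
  obtain \<D> where \<D>: "countable \<D>" "\<D> \<subseteq> Pow S" "\<And>X. X \<in> \<D> \<Longrightarrow> \<exists>a b. X = cbox a b" "\<Union>\<D> = S"
    using open_countable_Union_open_cbox[OF S] by metis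
  have "AE x in lebesgue. x \<in> X \<longrightarrow> g x = 0" if X: "X \<in> \<D>" for X
  proof -
    obtain a b where "X = cbox a b" using \<D>(3)[OF X] by blast
    moreover have "X \<subseteq> S" using \<D>(2) X by blast
    ultimately show ?thesis using cbox by simp
  qed
  then have "AE x in lebesgue. \<forall>X\<in>\<D>. x \<in> X \<longrightarrow> g x = 0"
    using \<D>(1) by (subst AE_ball_countable) auto
  then show ?thesis by eventually_elim (use \<D>(4) in blast)
qed

section \<open>Weak gradients\<close>

lemma set_integral_eq_if_eq_on:
  fixes f g :: "real ^ 'n \<Rightarrow> real"
  assumes "\<And>x. x \<in> S \<Longrightarrow> x \<in> T \<Longrightarrow> f x = g x" "\<And>x. x \<in> S \<Longrightarrow> x \<notin> T \<Longrightarrow> f x = 0"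
    "\<And>x. x \<in> T \<Longrightarrow> x \<notin> S \<Longrightarrow> g x = 0"
  shows "(LINT x:S|lebesgue. f x) = (LINT x:T|lebesgue. g x)"
  unfolding set_lebesgue_integral_def
  by (intro Bochner_Integration.integral_cong) (use assms in \<open>auto simp: indicator_def\<close>)

lemma open_sets_lebesgue: "open S \<Longrightarrow> S \<in> sets lebesgue"
  by auto

lemma test_function_L2:
  assumes "v \<in> test_functions T" "S \<in> sets lebesgue"
  shows "v \<in> L2 S" "partial j v \<in> L2 S" "(\<lambda>x. \<chi> j. partial j v x) \<in> L2 S"
proof -
  obtain C where C: "compact C" "C \<subseteq> T" "\<And>x. x \<notin> C \<Longrightarrow> v x = 0" "\<And>j x. x \<notin> C \<Longrightarrow> partial j v x = 0"
    using test_functionE[OF assms(1)] by metis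
  have cont: "continuous_on UNIV (\<lambda>x. \<chi> j. partial j v x)"
    using test_function_C1(3)[OF assms(1)] by (intro continuous_on_vec_lambda) simp
  have zero: "(\<chi> j. partial j v x) = 0" if "x \<notin> C" for x
    using C(4)[OF that] by (simp add: vec_eq_iff)
  show "v \<in> L2 S" "partial j v \<in> L2 S" "(\<lambda>x. \<chi> j. partial j v x) \<in> L2 S"
    using compact_support_L2[OF test_function_C1(2)[OF assms(1)] C(1,3) assms(2)]
      compact_support_L2[OF test_function_C1(3)[OF assms(1)] C(1) C(4) assms(2)]
      compact_support_L2[OF cont C(1) zero assms(2)] by auto
qed

lemma test_function_eq_0:
  assumes "v \<in> test_functions S" "x \<notin> S"
  shows "v x = 0" "partial j v x = 0"
  using test_functionE[OF assms(1)] assms(2) by (metis subsetD)+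

lemma weak_gradient_wgrad: "u \<in> H1 S \<Longrightarrow> is_weak_gradient S u (wgrad S u)"
  unfolding H1_def wgrad_def by (auto intro: someI[of "is_weak_gradient S u"])

lemma weak_gradient_L2: "is_weak_gradient S u G \<Longrightarrow> G \<in> L2 S"
  by (simp add: is_weak_gradient_def)

lemma H1_L2: "u \<in> H1 S \<Longrightarrow> u \<in> L2 S"
  by (simp add: H1_def)

lemma H10_H1: "u \<in> H10 S \<Longrightarrow> u \<in> H1 S"
  by (simp add: H10_def)

lemma H1I: "u \<in> L2 S \<Longrightarrow> is_weak_gradient S u G \<Longrightarrow> u \<in> H1 S"
  by (auto simp: H1_def)

text \<open>
  This makes computations with \<open>wgrad\<close>, a weak gradient picked by a choice operator, possible: any
  weak gradient at hand may replace it under an integral.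
\<close>

lemma weak_gradient_unique:
  assumes S: "open S" and G: "is_weak_gradient S u G" and H: "is_weak_gradient S u H"
  shows "AE x in lebesgue. x \<in> S \<longrightarrow> G x = H x"
proof -
  have "AE x in lebesgue. x \<in> S \<longrightarrow> G x $ j - H x $ j = 0" for j
  proof (rule fundamental_lemma[OF S])
    show "(\<lambda>x. G x $ j - H x $ j) \<in> L2 S"
      by (intro L2_diff L2_component weak_gradient_L2[OF G] weak_gradient_L2[OF H])
    fix v assume v: "v \<in> test_functions S"
    have i: "set_integrable lebesgue S (\<lambda>x. G x $ j * v x)" "set_integrable lebesgue S (\<lambda>x. H x $ j * v x)"
      by (intro L2_mult_integrable L2_component weak_gradient_L2[OF G] weak_gradient_L2[OF H]
          test_function_L2(1)[OF v] open_sets_lebesgue[OF S])+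
    show "(LINT x:S|lebesgue. (G x $ j - H x $ j) * v x) = 0"
      using G H v set_integral_diff(2)[OF i] by (simp add: is_weak_gradient_def left_diff_distrib)
  qed
  then have "AE x in lebesgue. \<forall>j. x \<in> S \<longrightarrow> G x $ j - H x $ j = 0"
    by (subst AE_all_countable) auto
  then show ?thesis by eventually_elim (auto simp: vec_eq_iff)
qed

lemma weak_gradient_cong:
  assumes G: "is_weak_gradient S u G" and uv: "AE x in lebesgue. x \<in> S \<longrightarrow> u x = v x"
  shows "is_weak_gradient S v G"
proof -
  have "(LINT x:S|lebesgue. v x * partial j w x) = (LINT x:S|lebesgue. u x * partial j w x)" for w j
    by (rule set_integral_cong_AE_lebesgue) (use uv in \<open>eventually_elim, auto\<close>)
  then show ?thesis using G by (simp add: is_weak_gradient_def)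
qed

lemma weak_gradient_subset:
  assumes G: "is_weak_gradient S u G" and T: "open T" "T \<subseteq> S"
  shows "is_weak_gradient T u G"
  unfolding is_weak_gradient_def
proof (intro conjI ballI allI)
  show "G \<in> L2 T" by (rule L2_subset[OF weak_gradient_L2[OF G] T(2) open_sets_lebesgue[OF T(1)]])
  fix v j assume v: "v \<in> test_functions T"
  have vS: "v \<in> test_functions S" using test_functions_mono[OF T(2)] v by blast
  have "(LINT x:T|lebesgue. u x * partial j v x) = (LINT x:S|lebesgue. u x * partial j v x)"
    by (rule set_integral_eq_if_eq_on) (use T(2) in \<open>auto simp: test_function_eq_0[OF v]\<close>)
  also have "\<dots> = - (LINT x:S|lebesgue. G x $ j * v x)"
    using G vS by (simp add: is_weak_gradient_def)
  also have "(LINT x:S|lebesgue. G x $ j * v x) = (LINT x:T|lebesgue. G x $ j * v x)"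
    by (rule set_integral_eq_if_eq_on) (use T(2) in \<open>auto simp: test_function_eq_0[OF v]\<close>)
  finally show "(LINT x:T|lebesgue. u x * partial j v x) = - (LINT x:T|lebesgue. G x $ j * v x)" .
qed

lemma weak_gradient_add:
  assumes S: "open S" and u: "u \<in> L2 S" "is_weak_gradient S u G" and v: "v \<in> L2 S" "is_weak_gradient S v H"
  shows "is_weak_gradient S (\<lambda>x. u x + v x) (\<lambda>x. G x + H x)"
  unfolding is_weak_gradient_def
proof (intro conjI ballI allI)
  show "(\<lambda>x. G x + H x) \<in> L2 S" by (intro L2_add weak_gradient_L2[OF u(2)] weak_gradient_L2[OF v(2)])
  fix w j assume w: "w \<in> test_functions S"
  note wL2 = test_function_L2[OF w open_sets_lebesgue[OF S]]
  have i: "set_integrable lebesgue S (\<lambda>x. u x * partial j w x)" "set_integrable lebesgue S (\<lambda>x. v x * partial j w x)"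
    "set_integrable lebesgue S (\<lambda>x. G x $ j * w x)" "set_integrable lebesgue S (\<lambda>x. H x $ j * w x)"
    by (intro L2_mult_integrable L2_component u v weak_gradient_L2[OF u(2)] weak_gradient_L2[OF v(2)] wL2)+
  show "(LINT x:S|lebesgue. (u x + v x) * partial j w x) = - (LINT x:S|lebesgue. (G x + H x) $ j * w x)"
    using u(2) v(2) w set_integral_add(2)[OF i(1,2)] set_integral_add(2)[OF i(3,4)]
    by (simp add: is_weak_gradient_def distrib_right)
qed

lemma weak_gradient_uminus:
  assumes "is_weak_gradient S u G"
  shows "is_weak_gradient S (\<lambda>x. - u x) (\<lambda>x. - G x)"
  using assms L2_uminus[of G S] by (auto simp: is_weak_gradient_def set_lebesgue_integral_def)

lemma weak_gradient_diff:
  assumes S: "open S" and u: "u \<in> L2 S" "is_weak_gradient S u G" and v: "v \<in> L2 S" "is_weak_gradient S v H"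
  shows "is_weak_gradient S (\<lambda>x. u x - v x) (\<lambda>x. G x - H x)"
  using weak_gradient_add[OF S u L2_uminus[OF v(1)] weak_gradient_uminus[OF v(2)]] by simp

lemma H1_diff:
  assumes S: "open S" and u: "u \<in> H1 S" and v: "v \<in> H1 S"
  shows "(\<lambda>x. u x - v x) \<in> H1 S"
  using H1I[OF L2_diff[OF H1_L2[OF u] H1_L2[OF v]]
    weak_gradient_diff[OF S H1_L2[OF u] weak_gradient_wgrad[OF u] H1_L2[OF v] weak_gradient_wgrad[OF v]]] .

lemma H1_add:
  assumes S: "open S" and u: "u \<in> H1 S" and v: "v \<in> H1 S"
  shows "(\<lambda>x. u x + v x) \<in> H1 S"
  using H1I[OF L2_add[OF H1_L2[OF u] H1_L2[OF v]]
    weak_gradient_add[OF S H1_L2[OF u] weak_gradient_wgrad[OF u] H1_L2[OF v] weak_gradient_wgrad[OF v]]] .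

lemma H1_cong:
  assumes "u \<in> H1 S" "AE x in lebesgue. x \<in> S \<longrightarrow> u x = v x"
  shows "v \<in> H1 S"
  by (rule H1I[OF L2_cong_AE[OF H1_L2[OF assms(1)] assms(2)]
    weak_gradient_cong[OF weak_gradient_wgrad[OF assms(1)] assms(2)]])

lemma H1_subset:
  assumes "u \<in> H1 S" "open T" "T \<subseteq> S"
  shows "u \<in> H1 T"
  by (rule H1I[OF L2_subset[OF H1_L2[OF assms(1)] assms(3) open_sets_lebesgue[OF assms(2)]]
    weak_gradient_subset[OF weak_gradient_wgrad[OF assms(1)] assms(2,3)]])

text \<open>
  The supports of \<open>s\<close> and \<open>v\<close> may lie in different open sets. This is what makes the extension by zero work,
  where \<open>s\<close> approximates a function on \<open>S\<close> while \<open>v\<close> tests on another set.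
\<close>

lemma integration_by_parts:
  assumes s: "s \<in> test_functions S" and v: "v \<in> test_functions T"
  shows "(LINT x|lebesgue. s x * partial j v x) = - (LINT x|lebesgue. partial j s x * v x)"
proof -
  note c = test_function_C1[OF s] test_function_C1[OF v]
  obtain C where C: "compact C" "\<And>x. x \<notin> C \<Longrightarrow> s x = 0"
    using test_functionE[OF s] by metis
  have L2: "s \<in> L2 UNIV" "v \<in> L2 UNIV" "partial j s \<in> L2 UNIV" "partial j v \<in> L2 UNIV"
    by (rule test_function_L2[OF s] test_function_L2[OF v]; simp)+
  have i: "integrable lebesgue (\<lambda>x. partial j s x * v x)" "integrable lebesgue (\<lambda>x. s x * partial j v x)"
    using L2_mult_integrable[OF L2(3,2)] L2_mult_integrable[OF L2(1,4)] by (simp_all add: set_integrable_def)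
  have p: "partial j (\<lambda>x. s x * v x) = (\<lambda>x. partial j s x * v x + s x * partial j v x)"
    by (rule ext, rule partial_mult) (use c in auto)
  have cont: "continuous_on UNIV (partial j (\<lambda>x. s x * v x))"
    unfolding p by (intro continuous_intros c)
  have "0 = (LINT x|lborel. partial j (\<lambda>x. s x * v x) x)"
    by (rule integral_partial_eq_0[symmetric, OF _ cont C(1)]) (use c C(2) in auto)
  also have "\<dots> = (LINT x|lebesgue. partial j (\<lambda>x. s x * v x) x)"
    by (rule integral_completion[symmetric]) (use borel_measurable_continuous_onI[OF cont] in simp)
  also have "\<dots> = (LINT x|lebesgue. partial j s x * v x) + (LINT x|lebesgue. s x * partial j v x)"
    unfolding p by (rule Bochner_Integration.integral_add[OF i])
  finally show ?thesis by simp
qed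

lemma test_function_weak_gradient:
  assumes s: "s \<in> test_functions S" and T: "T \<in> sets lebesgue"
  shows "is_weak_gradient T s (\<lambda>x. \<chi> j. partial j s x)"
  unfolding is_weak_gradient_def
proof (intro conjI ballI allI)
  show "(\<lambda>x. \<chi> j. partial j s x) \<in> L2 T" by (rule test_function_L2(3)[OF s T])
  fix v j assume v: "v \<in> test_functions T"
  have "(LINT x:T|lebesgue. s x * partial j v x) = (LINT x:UNIV|lebesgue. s x * partial j v x)"
    by (rule set_integral_eq_if_eq_on) (auto simp: test_function_eq_0[OF v])
  moreover have "(LINT x:T|lebesgue. (\<chi> j. partial j s x) $ j * v x) = (LINT x:UNIV|lebesgue. partial j s x * v x)"
    by (rule set_integral_eq_if_eq_on) (auto simp: test_function_eq_0[OF v])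
  ultimately show "(LINT x:T|lebesgue. s x * partial j v x) = - (LINT x:T|lebesgue. (\<chi> j. partial j s x) $ j * v x)"
    using integration_by_parts[OF s v, of j] by (simp add: set_lebesgue_integral_def)
qed

section \<open>Extension by zero\<close>

definition zero_extension :: "'a set \<Rightarrow> ('a \<Rightarrow> 'b::zero) \<Rightarrow> 'a \<Rightarrow> 'b" where
  "zero_extension S u x = (if x \<in> S then u x else 0)"

lemma zero_extension_L2:
  assumes "u \<in> L2 S" "T \<in> sets lebesgue"
  shows "zero_extension S u \<in> L2 T"
proof -
  have eq: "(\<lambda>x. indicator UNIV x *\<^sub>R zero_extension S u x) = (\<lambda>x. indicator S x *\<^sub>R u x)"
    by (auto simp: zero_extension_def indicator_def)
  have "zero_extension S u \<in> L2 UNIV"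
    using assms(1) unfolding L2_iff eq fun_cong[OF eq] .
  from L2_subset[OF this _ assms(2)] show ?thesis by simp
qed

text \<open>
  Young's inequality \<open>\<bar>a b\<bar> \<le> a\<^sup>2 / t + t b\<^sup>2\<close> bounds each integral; \<open>t\<close> is chosen small enough for
  the fixed function \<open>h\<close>, and then \<open>n\<close> large enough for \<open>t\<close>.
\<close>

lemma L2_tendsto_0_mult:
  fixes d :: "nat \<Rightarrow> real ^ 'n \<Rightarrow> real"
  assumes d: "\<And>n. d n \<in> L2 S" and h: "h \<in> L2 S"
    and le: "\<And>n. (LINT x:S|lebesgue. (d n x)\<^sup>2) \<le> e n" and e: "e \<longlonglongrightarrow> 0"
  shows "(\<lambda>n. LINT x:S|lebesgue. d n x * h x) \<longlonglongrightarrow> 0"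
proof (rule LIMSEQ_I)
  fix \<epsilon> :: real assume \<epsilon>: "\<epsilon> > 0"
  define B where "B = (LINT x:S|lebesgue. (h x)\<^sup>2)"
  have B: "B \<ge> 0" unfolding B_def set_lebesgue_integral_def by (intro Bochner_Integration.integral_nonneg) simp
  define t where "t = \<epsilon> / (2 * (B + 1))"
  have t: "t > 0" using \<epsilon> B by (simp add: t_def)
  have ih: "set_integrable lebesgue S (\<lambda>x. (h x)\<^sup>2)"
    using L2_mult_integrable[OF h h] by (simp add: power2_eq_square)
  have bound: "\<bar>LINT x:S|lebesgue. d n x * h x\<bar> \<le> (LINT x:S|lebesgue. (d n x)\<^sup>2) / t + t * B" for n
  proof -
    have id: "set_integrable lebesgue S (\<lambda>x. (d n x)\<^sup>2)"
      using L2_mult_integrable[OF d d] by (simp add: power2_eq_square)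
    have young: "\<bar>a * b\<bar> \<le> a\<^sup>2 / t + t * b\<^sup>2" for a b :: real
    proof -
      have "2 * (\<bar>a\<bar> / sqrt t) * (sqrt t * \<bar>b\<bar>) \<le> (\<bar>a\<bar> / sqrt t)\<^sup>2 + (sqrt t * \<bar>b\<bar>)\<^sup>2"
        by (rule sum_squares_bound)
      then have "2 * \<bar>a * b\<bar> \<le> a\<^sup>2 / t + t * b\<^sup>2"
        using t by (simp add: power_divide power_mult_distrib abs_mult)
      then show ?thesis using abs_ge_zero[of "a * b"] by linarith
    qed
    have i2: "set_integrable lebesgue S (\<lambda>x. (d n x)\<^sup>2 / t + t * (h x)\<^sup>2)"
      using id ih by (intro set_integral_add(1) set_integrable_divide set_integrable_mult_right)
    have "\<bar>LINT x:S|lebesgue. d n x * h x\<bar> \<le> (LINT x:S|lebesgue. \<bar>d n x * h x\<bar>)"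
      using set_integral_norm_bound[OF L2_mult_integrable[OF d h]] by simp
    also have "\<dots> \<le> (LINT x:S|lebesgue. (d n x)\<^sup>2 / t + t * (h x)\<^sup>2)"
      by (rule set_integral_mono[OF set_integrable_abs[OF L2_mult_integrable[OF d h]] i2 young])
    also have "\<dots> = (LINT x:S|lebesgue. (d n x)\<^sup>2) / t + t * B"
      unfolding B_def using set_integral_add(2)[OF set_integrable_divide[OF id] set_integrable_mult_right[OF ih]]
      by (simp add: set_integral_divide_zero set_integral_mult_right)
    finally show ?thesis .
  qed
  obtain N where N: "\<And>n. n \<ge> N \<Longrightarrow> \<bar>e n\<bar> < \<epsilon> / 2 * t"
    using LIMSEQ_D[OF e, of "\<epsilon> / 2 * t"] \<epsilon> t by auto
  show "\<exists>N. \<forall>n\<ge>N. norm ((LINT x:S|lebesgue. d n x * h x) - 0) < \<epsilon>"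
  proof (intro exI allI impI)
    fix n assume "n \<ge> N"
    then have "(LINT x:S|lebesgue. (d n x)\<^sup>2) < \<epsilon> / 2 * t" using N[of n] le[of n] by simp
    then have "(LINT x:S|lebesgue. (d n x)\<^sup>2) / t < \<epsilon> / 2" using t by (simp add: divide_less_eq)
    moreover have "t * B \<le> \<epsilon> / 2" using \<epsilon> B by (simp add: t_def field_simps)
    ultimately have "\<bar>LINT x:S|lebesgue. d n x * h x\<bar> < \<epsilon>" using bound[of n] by linarith
    then show "norm ((LINT x:S|lebesgue. d n x * h x) - 0) < \<epsilon>" by simp
  qed
qed

text \<open>
  If test functions \<open>s n\<close> approximate \<open>v\<close>, then their classical gradients approximate \<open>wgrad S v\<close>, and for
  each \<open>s n\<close> integration by parts holds against test functions that do not vanish on the boundary of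
  \<open>S\<close>. The identity survives in the limit. In the application \<open>S\<close> and \<open>T\<close> are two overlapping subdomains.
\<close>

lemma zero_extension_weak_gradient:
  assumes S: "open S" and T: "open T" and v: "v \<in> H10 S"
  shows "is_weak_gradient T (zero_extension S v) (zero_extension S (wgrad S v))"
  unfolding is_weak_gradient_def
proof (intro conjI ballI allI)
  define G where "G = wgrad S v"
  have vH1: "v \<in> H1 S" by (rule H10_H1[OF v])
  have vL2: "v \<in> L2 S" by (rule H1_L2[OF vH1])
  have G: "is_weak_gradient S v G" unfolding G_def by (rule weak_gradient_wgrad[OF vH1])
  note GL2 = weak_gradient_L2[OF G]
  show "zero_extension S (wgrad S v) \<in> L2 T"
    using zero_extension_L2[OF GL2 open_sets_lebesgue[OF T]] by (simp add: G_def)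
  fix w j assume w: "w \<in> test_functions T"
  obtain s where s: "\<And>n. s n \<in> test_functions S" and lim: "(\<lambda>n. H1_norm S (\<lambda>x. s n x - v x)) \<longlonglongrightarrow> 0"
    using v unfolding H10_def by blast
  note Sm = open_sets_lebesgue[OF S]
  note sL2 = test_function_L2[OF s Sm]
  note wL2 = test_function_L2[OF w Sm]
  define e where "e n = (H1_norm S (\<lambda>x. s n x - v x))\<^sup>2" for n
  have e0: "e \<longlonglongrightarrow> 0" using tendsto_power[OF lim, of 2] by (simp add: e_def[abs_def])
  define W where "W n = wgrad S (\<lambda>x. s n x - v x)" for n
  have sg: "is_weak_gradient S (s n) (\<lambda>x. \<chi> j. partial j (s n) x)" for n
    by (rule test_function_weak_gradient[OF s Sm])
  have dH1: "(\<lambda>x. s n x - v x) \<in> H1 S" for n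
    by (rule H1_diff[OF S H1I[OF sL2(1) sg] vH1])
  have Wg: "is_weak_gradient S (\<lambda>x. s n x - v x) (W n)" for n
    unfolding W_def by (rule weak_gradient_wgrad[OF dH1])
  note WL2 = weak_gradient_L2[OF Wg]
  \<comment> \<open>The \<open>H1\<close> norm of \<open>s n - v\<close> involves the chosen gradient \<open>W n\<close>, which by uniqueness is the expected
    difference.\<close>
  have W_eq: "AE x in lebesgue. x \<in> S \<longrightarrow> W n x = (\<chi> j. partial j (s n) x) - G x" for n
    by (rule weak_gradient_unique[OF S Wg weak_gradient_diff[OF S sL2(1) sg vL2 G]])
  have i1: "set_integrable lebesgue S (\<lambda>x. (s n x - v x)\<^sup>2)" for n
    using L2_mult_integrable[OF H1_L2[OF dH1] H1_L2[OF dH1]] by (simp add: power2_eq_square)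
  have i2: "set_integrable lebesgue S (\<lambda>x. (norm (W n x))\<^sup>2)" for n
    using WL2[of n] by (simp add: L2_def)
  have i3: "set_integrable lebesgue S (\<lambda>x. (W n x $ j)\<^sup>2)" for n
    using L2_mult_integrable[OF L2_component[OF WL2] L2_component[OF WL2]] by (simp add: power2_eq_square)
  have e_eq: "e n = (LINT x:S|lebesgue. (s n x - v x)\<^sup>2 + (norm (W n x))\<^sup>2)" for n
    unfolding e_def H1_norm_def W_def set_lebesgue_integral_def
    by (intro real_sqrt_pow2 Bochner_Integration.integral_nonneg) simp
  have le1: "(LINT x:S|lebesgue. (s n x - v x)\<^sup>2) \<le> e n" for n
    unfolding e_eq by (rule set_integral_mono[OF i1 set_integral_add(1)[OF i1 i2]]) simp
  have le2: "(LINT x:S|lebesgue. (W n x $ j)\<^sup>2) \<le> e n" for n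
    unfolding e_eq
  proof (rule set_integral_mono[OF i3 set_integral_add(1)[OF i1 i2]])
    show "(W n x $ j)\<^sup>2 \<le> (s n x - v x)\<^sup>2 + (norm (W n x))\<^sup>2" for x
      using power_mono[OF component_le_norm_cart[of "W n x" j] abs_ge_zero, of 2] by (simp add: add_increasing)
  qed
  have lim1: "(\<lambda>n. LINT x:S|lebesgue. (s n x - v x) * partial j w x) \<longlonglongrightarrow> 0"
    by (rule L2_tendsto_0_mult[OF H1_L2[OF dH1] wL2(2) le1 e0])
  have lim2: "(\<lambda>n. LINT x:S|lebesgue. W n x $ j * w x) \<longlonglongrightarrow> 0"
    by (rule L2_tendsto_0_mult[OF L2_component[OF WL2] wL2(1) le2 e0])
  \<comment> \<open>The claim is that \<open>?c\<close> is \<open>0\<close>. The two integrals that tend to \<open>0\<close> add up to \<open>- ?c\<close> for every \<open>n\<close>,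
    since the contributions of \<open>s n\<close> cancel.\<close>
  let ?c = "(LINT x:S|lebesgue. v x * partial j w x) + (LINT x:S|lebesgue. G x $ j * w x)"
  have "(LINT x:S|lebesgue. (s n x - v x) * partial j w x) + (LINT x:S|lebesgue. W n x $ j * w x) = - ?c" for n
  proof -
    have 1: "(LINT x:S|lebesgue. (s n x - v x) * partial j w x) =
        (LINT x:S|lebesgue. s n x * partial j w x) - (LINT x:S|lebesgue. v x * partial j w x)"
      unfolding left_diff_distrib
      by (intro set_integral_diff(2) L2_mult_integrable sL2(1) vL2 wL2(2))
    have "(LINT x:S|lebesgue. W n x $ j * w x) = (LINT x:S|lebesgue. (partial j (s n) x - G x $ j) * w x)"
      by (rule set_integral_cong_AE_lebesgue) (use W_eq[of n] in \<open>eventually_elim, auto\<close>)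
    also have "\<dots> = (LINT x:S|lebesgue. partial j (s n) x * w x) - (LINT x:S|lebesgue. G x $ j * w x)"
      unfolding left_diff_distrib
      by (intro set_integral_diff(2) L2_mult_integrable L2_component sL2(2) GL2 wL2(1))
    finally have 2: "(LINT x:S|lebesgue. W n x $ j * w x) =
        (LINT x:S|lebesgue. partial j (s n) x * w x) - (LINT x:S|lebesgue. G x $ j * w x)" .
    have "(LINT x:S|lebesgue. s n x * partial j w x) = (LINT x:UNIV|lebesgue. s n x * partial j w x)"
      "(LINT x:S|lebesgue. partial j (s n) x * w x) = (LINT x:UNIV|lebesgue. partial j (s n) x * w x)"
      by (rule set_integral_eq_if_eq_on; simp add: test_function_eq_0[OF s])+
    then show ?thesis using 1 2 integration_by_parts[OF s[of n] w, of j] by (simp add: set_lebesgue_integral_def)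
  qed
  then have "?c = 0" using tendsto_add[OF lim1 lim2] by (simp add: LIMSEQ_const_iff)
  moreover have "(LINT x:T|lebesgue. zero_extension S v x * partial j w x) = (LINT x:S|lebesgue. v x * partial j w x)"
    "(LINT x:T|lebesgue. zero_extension S G x $ j * w x) = (LINT x:S|lebesgue. G x $ j * w x)"
    by (rule set_integral_eq_if_eq_on; simp add: zero_extension_def test_function_eq_0[OF w])+
  ultimately show "(LINT x:T|lebesgue. zero_extension S v x * partial j w x) =
      - (LINT x:T|lebesgue. zero_extension S (wgrad S v) x $ j * w x)"
    by (simp add: G_def)
qed

lemma zero_extension_H1:
  assumes "open S" "open T" "v \<in> H10 S"
  shows "zero_extension S v \<in> H1 T"
  using H1I[OF zero_extension_L2[OF H1_L2[OF H10_H1[OF assms(3)]] open_sets_lebesgue[OF assms(2)]]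
    zero_extension_weak_gradient[OF assms]] .

section \<open>The elliptic form\<close>

lemma set_integrable_bounded_mult:
  fixes a f :: "real ^ 'n \<Rightarrow> real"
  assumes a: "set_borel_measurable lebesgue S a" "\<And>x. x \<in> S \<Longrightarrow> \<bar>a x\<bar> \<le> M"
    and f: "set_integrable lebesgue S f"
  shows "set_integrable lebesgue S (\<lambda>x. a x * f x)"
proof -
  let ?a = "\<lambda>x. indicator S x *\<^sub>R a x" and ?f = "\<lambda>x. indicator S x *\<^sub>R f x"
  have [measurable]: "?a \<in> borel_measurable lebesgue" "?f \<in> borel_measurable lebesgue"
    using a(1) f by (auto simp: set_borel_measurable_def set_integrable_def)
  have eq: "(\<lambda>x. indicator S x *\<^sub>R (a x * f x)) = (\<lambda>x. ?a x * ?f x)"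
    by (auto simp: indicator_def fun_eq_iff)
  have "integrable lebesgue (\<lambda>x. ?a x * ?f x)"
  proof (rule Bochner_Integration.integrable_bound)
    show "integrable lebesgue (\<lambda>x. M * ?f x)"
      using f unfolding set_integrable_def by (rule integrable_mult_right)
    have "norm (?a x * ?f x) \<le> norm (M * ?f x)" for x
    proof (cases "x \<in> S")
      case True
      then have "\<bar>a x\<bar> \<le> \<bar>M\<bar>" using a(2)[OF True] by linarith
      then show ?thesis using True by (simp add: abs_mult mult_right_mono)
    qed simp
    then show "AE x in lebesgue. norm (?a x * ?f x) \<le> norm (M * ?f x)" by (intro AE_I2)
  qed measurable
  then show ?thesis unfolding set_integrable_def eq .
qed

lemma set_integrable_finite_sum:
  fixes f :: "'i \<Rightarrow> 'a \<Rightarrow> real"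
  assumes "\<And>i. i \<in> I \<Longrightarrow> set_integrable M S (f i)"
  shows "set_integrable M S (\<lambda>x. \<Sum>i\<in>I. f i x)"
  using assms unfolding set_integrable_def scaleR_sum_right by (intro Bochner_Integration.integrable_sum)

lemma set_borel_measurable_comp_linear:
  fixes F :: "real ^ 'n \<Rightarrow> 'b::euclidean_space" and L :: "'b \<Rightarrow> real"
  assumes F: "set_borel_measurable lebesgue \<Omega> F" and S: "S \<subseteq> \<Omega>" "S \<in> sets lebesgue"
    and L: "linear L"
  shows "set_borel_measurable lebesgue S (\<lambda>x. L (F x))"
proof -
  have [measurable]: "L \<in> borel_measurable borel"
    using L by (intro borel_measurable_continuous_onI linear_continuous_on) (simp add: linear_conv_bounded_linear)
  have [measurable]: "(\<lambda>x. indicator \<Omega> x *\<^sub>R F x) \<in> borel_measurable lebesgue"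
    using F by (simp add: set_borel_measurable_def)
  have "(\<lambda>x. indicator S x *\<^sub>R L (indicator \<Omega> x *\<^sub>R F x)) \<in> borel_measurable lebesgue"
    using S(2) by measurable
  moreover have "(\<lambda>x. indicator S x *\<^sub>R L (indicator \<Omega> x *\<^sub>R F x)) = (\<lambda>x. indicator S x *\<^sub>R L (F x))"
    using S(1) by (auto simp: indicator_def fun_eq_iff)
  ultimately show ?thesis by (simp add: set_borel_measurable_def)
qed

text \<open>
  The integrand at one point, with the gradients as arguments of their own, so that any weak
  gradients may be inserted.
\<close>

definition elliptic_integrand ::
  "real ^ 'n ^ 'n \<Rightarrow> real ^ 'n \<Rightarrow> real \<Rightarrow> real \<Rightarrow> real ^ 'n \<Rightarrow> real \<Rightarrow> real ^ 'n \<Rightarrow> real" where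
  "elliptic_integrand A b c s g t h = (A *v g) \<bullet> h + (b \<bullet> g) * t + c * s * t"

lemma elliptic_integrable:
  assumes coeff: "elliptic_coefficients \<Omega> A b c" and S: "S \<subseteq> \<Omega>" "S \<in> sets lebesgue"
    and L2: "u \<in> L2 S" "G \<in> L2 S" "v \<in> L2 S" "H \<in> L2 S"
  shows "set_integrable lebesgue S (\<lambda>x. elliptic_integrand (A x) (b x) (c x) (u x) (G x) (v x) (H x))"
proof -
  obtain MA Mb Mc where M: "\<And>x. x \<in> \<Omega> \<Longrightarrow> norm (A x) \<le> MA" "\<And>x. x \<in> \<Omega> \<Longrightarrow> norm (b x) \<le> Mb"
    "\<And>x. x \<in> \<Omega> \<Longrightarrow> norm (c x) \<le> Mc"
    using coeff unfolding elliptic_coefficients_def bounded_iff by (metis imageI)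
  have A: "set_borel_measurable lebesgue S (\<lambda>x. A x $ i $ j)" for i j
    by (rule set_borel_measurable_comp_linear[OF _ S, where L = "\<lambda>M. M $ i $ j"])
       (use coeff in \<open>auto simp: elliptic_coefficients_def intro!: linearI\<close>)
  have b: "set_borel_measurable lebesgue S (\<lambda>x. b x $ j)" for j
    by (rule set_borel_measurable_comp_linear[OF _ S, where L = "\<lambda>y. y $ j"])
       (use coeff in \<open>auto simp: elliptic_coefficients_def intro!: linearI\<close>)
  have c: "set_borel_measurable lebesgue S c"
    by (rule set_borel_measurable_comp_linear[OF _ S, where L = "\<lambda>x. x"])
       (use coeff in \<open>auto simp: elliptic_coefficients_def intro!: linearI\<close>)
  have MA: "\<bar>A x $ i $ j\<bar> \<le> MA" if "x \<in> S" for x i j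
    using component_le_norm_cart[of "A x $ i" j] Finite_Cartesian_Product.norm_nth_le[of "A x" i] M(1)[of x] S(1) that by fastforce
  have Mb: "\<bar>b x $ j\<bar> \<le> Mb" if "x \<in> S" for x j
    using component_le_norm_cart[of "b x" j] M(2)[of x] S(1) that by fastforce
  have Mc: "\<bar>c x\<bar> \<le> Mc" if "x \<in> S" for x using M(3)[of x] S(1) that by auto
  \<comment> \<open>Written in components, each summand is a bounded measurable coefficient times a product of two
    square integrable functions.\<close>
  have eq: "elliptic_integrand (A x) (b x) (c x) (u x) (G x) (v x) (H x) =
      (\<Sum>i\<in>UNIV. \<Sum>j\<in>UNIV. A x $ i $ j * (G x $ j * H x $ i)) +
      (\<Sum>j\<in>UNIV. b x $ j * (G x $ j * v x)) + c x * (u x * v x)" for x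
    by (simp add: elliptic_integrand_def inner_vec_def matrix_vector_mult_def sum_distrib_left sum_distrib_right mult_ac)
  show ?thesis
    unfolding eq
    by (intro set_integral_add(1) set_integrable_finite_sum
        set_integrable_bounded_mult[OF A MA] set_integrable_bounded_mult[OF b Mb]
        set_integrable_bounded_mult[OF c Mc] L2_mult_integrable L2_component L2)
qed

lemma elliptic_form_eq:
  assumes S: "open S" and G: "is_weak_gradient S u G" and H: "is_weak_gradient S v H"
  shows "elliptic_form A b c S u v =
    (LINT x:S|lebesgue. elliptic_integrand (A x) (b x) (c x) (u x) (G x) (v x) (H x))"
proof -
  have wg: "is_weak_gradient S u (wgrad S u)" "is_weak_gradient S v (wgrad S v)"
    unfolding wgrad_def
    using someI[of "is_weak_gradient S u", OF G] someI[of "is_weak_gradient S v", OF H] .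
  show ?thesis
    unfolding elliptic_form_def elliptic_integrand_def
  proof (rule set_integral_cong_AE_lebesgue)
    show "AE x in lebesgue. x \<in> S \<longrightarrow>
      (A x *v wgrad S u x) \<bullet> wgrad S v x + (b x \<bullet> wgrad S u x) * v x + c x * u x * v x =
      (A x *v G x) \<bullet> H x + (b x \<bullet> G x) * v x + c x * u x * v x"
      using weak_gradient_unique[OF S wg(1) G] weak_gradient_unique[OF S wg(2) H] by eventually_elim simp
  qed
qed

context
  fixes \<Omega> S :: "(real ^ 'n) set" and A :: "real ^ 'n \<Rightarrow> real ^ 'n ^ 'n" and b :: "real ^ 'n \<Rightarrow> real ^ 'n"
    and c :: "real ^ 'n \<Rightarrow> real"
  assumes coeff: "elliptic_coefficients \<Omega> A b c" and S: "open S" "S \<subseteq> \<Omega>"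
begin

lemma elliptic_form_add_left:
  assumes "u \<in> H1 S" "u' \<in> H1 S" "v \<in> H1 S"
  shows "elliptic_form A b c S (\<lambda>x. u x + u' x) v = elliptic_form A b c S u v + elliptic_form A b c S u' v"
proof -
  note wg = assms[THEN weak_gradient_wgrad] and L2 = assms[THEN H1_L2]
  note i = elliptic_integrable[OF coeff S(2) open_sets_lebesgue[OF S(1)]]
  show ?thesis
    unfolding elliptic_form_eq[OF S(1) weak_gradient_add[OF S(1) L2(1) wg(1) L2(2) wg(2)] wg(3)]
      elliptic_form_eq[OF S(1) wg(1) wg(3)] elliptic_form_eq[OF S(1) wg(2) wg(3)]
      set_integral_add(2)[OF i[OF L2(1) weak_gradient_L2[OF wg(1)] L2(3) weak_gradient_L2[OF wg(3)]]
        i[OF L2(2) weak_gradient_L2[OF wg(2)] L2(3) weak_gradient_L2[OF wg(3)]], symmetric]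
    by (simp add: elliptic_integrand_def algebra_simps matrix_vector_right_distrib inner_add_left inner_add_right)
qed

lemma elliptic_form_diff_right:
  assumes "u \<in> H1 S" "v \<in> H1 S" "v' \<in> H1 S"
  shows "elliptic_form A b c S u (\<lambda>x. v x - v' x) = elliptic_form A b c S u v - elliptic_form A b c S u v'"
proof -
  note wg = assms[THEN weak_gradient_wgrad] and L2 = assms[THEN H1_L2]
  note i = elliptic_integrable[OF coeff S(2) open_sets_lebesgue[OF S(1)]]
  show ?thesis
    unfolding elliptic_form_eq[OF S(1) wg(1) weak_gradient_diff[OF S(1) L2(2) wg(2) L2(3) wg(3)]]
      elliptic_form_eq[OF S(1) wg(1) wg(2)] elliptic_form_eq[OF S(1) wg(1) wg(3)]
      set_integral_diff(2)[OF i[OF L2(1) weak_gradient_L2[OF wg(1)] L2(2) weak_gradient_L2[OF wg(2)]]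
        i[OF L2(1) weak_gradient_L2[OF wg(1)] L2(3) weak_gradient_L2[OF wg(3)]], symmetric]
    by (simp add: elliptic_integrand_def algebra_simps inner_diff_right)
qed

end

lemma elliptic_form_cong_left:
  assumes S: "open S" and u: "u \<in> H1 S" and v: "v \<in> H1 S"
    and ae: "AE x in lebesgue. x \<in> S \<longrightarrow> u x = u' x"
  shows "elliptic_form A b c S u v = elliptic_form A b c S u' v"
  unfolding elliptic_form_eq[OF S weak_gradient_wgrad[OF u] weak_gradient_wgrad[OF v]]
    elliptic_form_eq[OF S weak_gradient_cong[OF weak_gradient_wgrad[OF u] ae] weak_gradient_wgrad[OF v]]
  by (rule set_integral_cong_AE_lebesgue) (use ae in \<open>eventually_elim, auto\<close>)

text \<open>
  On \<open>S \<inter> T\<close> both sides have the same integrand, and on \<open>T - S\<close> the extended function and its weak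
  gradient vanish.
\<close>

lemma elliptic_form_zero_extension:
  assumes S: "open S" and T: "open T" and v: "v \<in> H10 S" and \<phi>: "\<phi> \<in> H1 T"
  shows "elliptic_form A b c (S \<inter> T) v \<phi> = elliptic_form A b c T (zero_extension S v) \<phi>"
proof -
  have ST: "open (S \<inter> T)" using S T by blast
  show ?thesis
    unfolding elliptic_form_eq[OF T zero_extension_weak_gradient[OF S T v] weak_gradient_wgrad[OF \<phi>]]
      elliptic_form_eq[OF ST weak_gradient_subset[OF weak_gradient_wgrad[OF H10_H1[OF v]] ST Int_lower1]
        weak_gradient_subset[OF weak_gradient_wgrad[OF \<phi>] ST Int_lower2]]
    by (rule set_integral_eq_if_eq_on) (auto simp: zero_extension_def elliptic_integrand_def)
qed

section \<open>Sums over the steps of an iteration\<close>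

text \<open>
  Induction along the steps of an iteration with \<open>K\<close> sweeps over \<open>p\<close> subdomains: step \<open>n + 1\<close> treats
  subdomain \<open>n mod p + 1\<close> in sweep \<open>n div p\<close>.
\<close>

lemma step_induct:
  fixes n p K :: nat
  assumes "n \<le> K * p" and base: "P 0"
    and step: "\<And>k i. k < K \<Longrightarrow> i \<in> {1..p} \<Longrightarrow> P (k * p + (i - 1)) \<Longrightarrow> P (k * p + i)"
  shows "P n"
  using assms(1)
proof (induction n)
  case 0
  show ?case by (rule base)
next
  case (Suc n)
  then have p: "p > 0" by (cases p) auto
  have "n div p < K" using Suc.prems p by (simp add: div_less_iff_less_mult)
  moreover have "n mod p + 1 \<in> {1..p}" using p by (simp add: Suc_leI)
  moreover have "n div p * p + (n mod p + 1 - 1) = n" "n div p * p + (n mod p + 1) = Suc n" by simp_all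
  ultimately show ?case using step[of "n div p" "n mod p + 1"] Suc by simp
qed

text \<open>
  The value after step \<open>j\<close> of sweep \<open>k\<close> collects the complete earlier sweeps and the beginning of
  the current one. It will be used for \<open>g n = (\<psi>, w n)\<close> and for \<open>g n = a\<^sub>j(w n, \<phi>)\<close>.
\<close>

lemma sum_increments:
  fixes g :: "nat \<Rightarrow> real" and d :: "nat \<Rightarrow> nat \<Rightarrow> real"
  assumes step: "\<And>k i. k < K \<Longrightarrow> i \<in> {1..p} \<Longrightarrow> g (k * p + i) = g (k * p + (i - 1)) + d k i"
  shows "k \<le> K \<Longrightarrow> g (k * p) = g 0 + (\<Sum>q<k. \<Sum>i=1..p. d q i)"
    and "k < K \<Longrightarrow> j \<le> p \<Longrightarrow>
      g (k * p + j) = g 0 + (\<Sum>q<k. \<Sum>i=1..p. d q i) + (\<Sum>i=1..j. d k i)"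
proof -
  have row: "g (k * p + j) = g (k * p) + (\<Sum>i=1..j. d k i)" if "k < K" "j \<le> p" for k j
    using that(2)
  proof (induction j)
    case (Suc j)
    then show ?case using step[OF that(1), of "Suc j"] by simp
  qed simp
  show *: "g (k * p) = g 0 + (\<Sum>q<k. \<Sum>i=1..p. d q i)" if "k \<le> K" for k
    using that
  proof (induction k)
    case (Suc k)
    then show ?case using row[of k p] by (simp add: add.commute)
  qed simp
  show "g (k * p + j) = g 0 + (\<Sum>q<k. \<Sum>i=1..p. d q i) + (\<Sum>i=1..j. d k i)" if "k < K" "j \<le> p"
    using row[OF that] *[of k] that by simp
qed

lemma sum_swap_lower_triangle:
  fixes X :: "nat \<Rightarrow> nat \<Rightarrow> real"
  shows "(\<Sum>k<K. \<Sum>q<k. X q k) = (\<Sum>q<K. \<Sum>k=q+1..<K. X q k)"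
  by (induction K) (simp_all add: sum.distrib)

lemma sum_swap_lower_triangle_closed:
  fixes X :: "nat \<Rightarrow> nat \<Rightarrow> real"
  shows "(\<Sum>j=1..p. \<Sum>i=1..j. X i j) = (\<Sum>i=1..p. \<Sum>j=i..p. X i j)"
proof (induction p)
  case (Suc p)
  have "(\<Sum>i=1..Suc p. \<Sum>j=i..Suc p. X i j) = (\<Sum>i=1..p. \<Sum>j=i..Suc p. X i j) + X (Suc p) (Suc p)"
    by simp
  also have "(\<Sum>i=1..p. \<Sum>j=i..Suc p. X i j) = (\<Sum>i=1..p. (\<Sum>j=i..p. X i j) + X i (Suc p))"
    by (intro sum.cong) auto
  finally show ?case using Suc by (simp add: sum.distrib)
qed simp

text \<open>
  Here \<open>F k j\<close> stands for \<open>a\<^sub>i\<^sub>j(v, \<phi> k j)\<close> with fixed \<open>i\<close> and \<open>v\<close>. By \<open>step\<close>, the part of sweep \<open>Q\<close> from \<open>i\<close> on cancels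
  the part of sweep \<open>Q + 1\<close> before \<open>i\<close>; going on like this, only the end of the last sweep survives.
\<close>

lemma adjoint_telescope:
  fixes F :: "nat \<Rightarrow> nat \<Rightarrow> real"
  assumes i: "i \<in> {1..p}" and Q: "Q < K"
    and last: "(\<Sum>j=i..p. F (K - 1) j) = D"
    and step: "\<And>Q. Q + 1 < K \<Longrightarrow> (\<Sum>j=i..p. F Q j) = - (\<Sum>j=1..<i. F (Q + 1) j)"
  shows "(\<Sum>k=Q+1..<K. \<Sum>j=1..p. F k j) + (\<Sum>j=i..p. F Q j) = D"
proof -
  have "Q \<le> K - 1" using Q by simp
  then show ?thesis
  proof (induction rule: inc_induct)
    case base
    then show ?case using last Q by simp
  next
    case (step n)
    have "(\<Sum>k=n+1..<K. \<Sum>j=1..p. F k j) = (\<Sum>j=1..p. F (n + 1) j) + (\<Sum>k=Suc n+1..<K. \<Sum>j=1..p. F k j)"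
      using step.hyps by (simp add: sum.atLeast_Suc_lessThan)
    moreover have "(\<Sum>j=1..p. F (n + 1) j) = (\<Sum>j=1..<i. F (n + 1) j) + (\<Sum>j=i..p. F (n + 1) j)"
    proof -
      have "{1..p} = {1..<i} \<union> {i..p}" using i by auto
      then show ?thesis by (simp add: sum.union_disjoint ivl_disj_int)
    qed
    ultimately show ?case using step.IH assms(4)[of n] step.hyps by simp
  qed
qed

section \<open>Duality along a multiplicative Schwarz iteration\<close>

lemma decomposition_subset: "overlapping_decomposition \<Omega> p \<omega> \<Longrightarrow> i \<in> {1..p} \<Longrightarrow> \<omega> i \<subseteq> \<Omega>"
  by (auto simp: overlapping_decomposition_def)

lemma decomposition_open: "overlapping_decomposition \<Omega> p \<omega> \<Longrightarrow> i \<in> {1..p} \<Longrightarrow> open (\<omega> i)"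
  by (auto simp: overlapping_decomposition_def)

lemma L2_inner_diff_right:
  assumes "f \<in> L2 S" "u \<in> L2 S" "v \<in> L2 S"
  shows "L2_inner S f (\<lambda>x. u x - v x) = L2_inner S f u - L2_inner S f v"
  unfolding L2_inner_def right_diff_distrib by (intro set_integral_diff(2) L2_mult_integrable assms)

lemma L2_inner_add_right:
  assumes "f \<in> L2 S" "u \<in> L2 S" "v \<in> L2 S"
  shows "L2_inner S f (\<lambda>x. u x + v x) = L2_inner S f u + L2_inner S f v"
  unfolding L2_inner_def distrib_left by (intro set_integral_add(2) L2_mult_integrable assms)

text \<open>
  The data of the last adjoint sweep: as \<open>\<eta> j\<close> vanishes outside \<open>\<omega> j\<close>, all overlap integrals may be
  extended to \<open>\<Omega>\<close>, where the weights sum to \<open>1\<close>.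
\<close>

lemma sum_L2_inner_partition:
  assumes dec: "overlapping_decomposition \<Omega> p \<omega>" and pu: "partition_of_unity \<Omega> p \<omega> \<eta>"
    and \<Omega>: "open \<Omega>" and \<psi>: "\<psi> \<in> L2 \<Omega>" and i: "i \<in> {1..p}" and v: "v \<in> L2 (\<omega> i)"
  shows "(\<Sum>j=1..p. L2_inner (\<omega> i \<inter> \<omega> j) v (\<lambda>x. \<eta> j x * \<psi> x)) = L2_inner \<Omega> \<psi> (zero_extension (\<omega> i) v)"
proof -
  let ?z = "zero_extension (\<omega> i) v"
  have z: "?z \<in> L2 \<Omega>" by (rule zero_extension_L2[OF v open_sets_lebesgue[OF \<Omega>]])
  have \<eta>: "set_borel_measurable lebesgue \<Omega> (\<eta> j)" "\<And>x. x \<in> \<Omega> \<Longrightarrow> 0 \<le> \<eta> j x"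
    "\<And>x. x \<in> \<Omega> \<Longrightarrow> x \<notin> \<omega> j \<Longrightarrow> \<eta> j x = 0" if "j \<in> {1..p}" for j
    using pu that by (auto simp: partition_of_unity_def)
  have \<eta>_sum: "(\<Sum>j=1..p. \<eta> j x) = 1" if "x \<in> \<Omega>" for x
    using pu that by (simp add: partition_of_unity_def)
  have \<eta>_le: "\<bar>\<eta> j x\<bar> \<le> 1" if "j \<in> {1..p}" "x \<in> \<Omega>" for j x
    using member_le_sum[of j "{1..p}" "\<lambda>j. \<eta> j x"] \<eta>(2) \<eta>_sum that by auto
  have int: "set_integrable lebesgue \<Omega> (\<lambda>x. \<eta> j x * (\<psi> x * ?z x))" if "j \<in> {1..p}" for j
    by (intro set_integrable_bounded_mult[where M = 1] \<eta> \<eta>_le that L2_mult_integrable \<psi> z)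
  have "L2_inner (\<omega> i \<inter> \<omega> j) v (\<lambda>x. \<eta> j x * \<psi> x) = (LINT x:\<Omega>|lebesgue. \<eta> j x * (\<psi> x * ?z x))"
    if "j \<in> {1..p}" for j
    unfolding L2_inner_def
    by (rule set_integral_eq_if_eq_on)
       (use decomposition_subset[OF dec i] \<eta>(3)[OF that] in \<open>auto simp: zero_extension_def\<close>)
  then have "(\<Sum>j=1..p. L2_inner (\<omega> i \<inter> \<omega> j) v (\<lambda>x. \<eta> j x * \<psi> x))
      = (\<Sum>j=1..p. (LINT x:\<Omega>|lebesgue. \<eta> j x * (\<psi> x * ?z x)))"
    by simp
  also have "\<dots> = (LINT x|lebesgue. (\<Sum>j=1..p. indicator \<Omega> x *\<^sub>R (\<eta> j x * (\<psi> x * ?z x))))"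
    unfolding set_lebesgue_integral_def
    by (rule Bochner_Integration.integral_sum[symmetric]) (use int in \<open>simp add: set_integrable_def\<close>)
  also have "\<dots> = L2_inner \<Omega> \<psi> ?z"
    unfolding L2_inner_def set_lebesgue_integral_def
  proof (rule Bochner_Integration.integral_cong[OF refl])
    fix x
    have "(\<Sum>j=1..p. \<eta> j x * (\<psi> x * ?z x)) = \<psi> x * ?z x" if "x \<in> \<Omega>"
      using \<eta>_sum[OF that] by (simp flip: sum_distrib_right)
    then show "(\<Sum>j=1..p. indicator \<Omega> x *\<^sub>R (\<eta> j x * (\<psi> x * ?z x))) = indicator \<Omega> x *\<^sub>R (\<psi> x * ?z x)"
      by (cases "x \<in> \<Omega>") simp_all
  qed
  finally show ?thesis .
qed

lemma adjoint_in_H10: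
  assumes "schwarz_adjoint A b c p \<omega> K \<eta> \<psi> \<phi>" "Q < K" "i \<in> {1..p}"
  shows "\<phi> Q i \<in> H10 (\<omega> i)"
  using assms by (auto simp: schwarz_adjoint_def unique_solution_def)

text \<open>
  The defining property of the adjoint functions in summed form: the pairings of \<open>v\<close> with all adjoint functions from
  \<open>(Q, i)\<close> onwards add up to \<open>(\<psi>, v)\<close>, irrespective of the sweep \<open>Q\<close>.
\<close>

lemma adjoint_tail_sum:
  assumes adj: "schwarz_adjoint A b c p \<omega> K \<eta> \<psi> \<phi>"
    and dec: "overlapping_decomposition \<Omega> p \<omega>" and pu: "partition_of_unity \<Omega> p \<omega> \<eta>"
    and \<Omega>: "open \<Omega>" and \<psi>: "\<psi> \<in> L2 \<Omega>"
    and Q: "Q < K" and i: "i \<in> {1..p}" and v: "v \<in> H10 (\<omega> i)"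
  shows "(\<Sum>k=Q+1..<K. \<Sum>j=1..p. elliptic_form A b c (\<omega> i \<inter> \<omega> j) v (\<phi> k j)) +
    (\<Sum>j=i..p. elliptic_form A b c (\<omega> i \<inter> \<omega> j) v (\<phi> Q j)) = L2_inner \<Omega> \<psi> (zero_extension (\<omega> i) v)"
proof (rule adjoint_telescope[OF i Q])
  have eq: "(\<Sum>j=i..p. elliptic_form A b c (\<omega> i \<inter> \<omega> j) v (\<phi> Q j)) =
      adjoint_data A b c p \<omega> K \<eta> \<psi> \<phi> Q i v" if "Q < K" for Q
  proof -
    have "elliptic_form A b c (\<omega> i) v (\<phi> Q i) = adjoint_data A b c p \<omega> K \<eta> \<psi> \<phi> Q i v
              - (\<Sum>j=i+1..p. elliptic_form A b c (\<omega> i \<inter> \<omega> j) v (\<phi> Q j))"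
      using adj that i v by (auto simp: schwarz_adjoint_def unique_solution_def)
    \<comment> \<open>The left hand side of the adjoint problem is the summand \<open>j = i\<close>.\<close>
    then show ?thesis using i by (simp add: sum.atLeast_Suc_atMost)
  qed
  show "(\<Sum>j=i..p. elliptic_form A b c (\<omega> i \<inter> \<omega> j) v (\<phi> (K - 1) j)) = L2_inner \<Omega> \<psi> (zero_extension (\<omega> i) v)"
    using eq[of "K - 1"] Q sum_L2_inner_partition[OF dec pu \<Omega> \<psi> i H1_L2[OF H10_H1[OF v]]]
    by (simp add: adjoint_data_def)
  show "(\<Sum>j=i..p. elliptic_form A b c (\<omega> i \<inter> \<omega> j) v (\<phi> Q j)) =
      - (\<Sum>j=1..<i. elliptic_form A b c (\<omega> i \<inter> \<omega> j) v (\<phi> (Q + 1) j))" if "Q + 1 < K" for Q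
    using eq[of Q] that by (simp add: adjoint_data_def)
qed

text \<open>
  The common structure of the continuum and the discrete iteration, which lets the duality argument
  be carried out once for both.
\<close>

definition subdomain_corrections ::
    "(real ^ 'n) set \<Rightarrow> nat \<Rightarrow> (nat \<Rightarrow> (real ^ 'n) set) \<Rightarrow> nat \<Rightarrow>
      (nat \<Rightarrow> real ^ 'n \<Rightarrow> real) \<Rightarrow> (nat \<Rightarrow> nat \<Rightarrow> real ^ 'n \<Rightarrow> real) \<Rightarrow> bool" where
  "subdomain_corrections \<Omega> p \<omega> K w \<delta> \<longleftrightarrow>
    (\<forall>k<K. \<forall>i\<in>{1..p}. \<delta> k i \<in> H10 (\<omega> i) \<and>
      (AE x in lebesgue. x \<in> \<Omega> \<longrightarrow>
        w (k * p + i) x = w (k * p + (i - 1)) x + zero_extension (\<omega> i) (\<delta> k i) x))"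

lemma subdomain_correctionsD:
  assumes "subdomain_corrections \<Omega> p \<omega> K w \<delta>" "k < K" "i \<in> {1..p}"
  shows "\<delta> k i \<in> H10 (\<omega> i)"
    and "AE x in lebesgue. x \<in> \<Omega> \<longrightarrow>
        w (k * p + (i - 1)) x + zero_extension (\<omega> i) (\<delta> k i) x = w (k * p + i) x"
proof -
  have *: "\<delta> k i \<in> H10 (\<omega> i) \<and> (AE x in lebesgue. x \<in> \<Omega> \<longrightarrow>
        w (k * p + i) x = w (k * p + (i - 1)) x + zero_extension (\<omega> i) (\<delta> k i) x)"
    using assms unfolding subdomain_corrections_def by blast
  then show "\<delta> k i \<in> H10 (\<omega> i)" by (rule conjunct1)
  from conjunct2[OF *] show "AE x in lebesgue. x \<in> \<Omega> \<longrightarrow>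
        w (k * p + (i - 1)) x + zero_extension (\<omega> i) (\<delta> k i) x = w (k * p + i) x"
    by eventually_elim simp
qed

lemma corrections_H1:
  assumes dec: "overlapping_decomposition \<Omega> p \<omega>" and \<Omega>: "open \<Omega>"
    and w: "w 0 \<in> H1 \<Omega>" "subdomain_corrections \<Omega> p \<omega> K w \<delta>" and n: "n \<le> K * p"
  shows "w n \<in> H1 \<Omega>"
  using n
proof (rule step_induct)
  show "w 0 \<in> H1 \<Omega>" by (rule w)
  fix k i assume k: "k < K" and i: "i \<in> {1..p}" and IH: "w (k * p + (i - 1)) \<in> H1 \<Omega>"
  note d = subdomain_correctionsD(1)[OF w(2) k i] and ae = subdomain_correctionsD(2)[OF w(2) k i]
  have "(\<lambda>x. w (k * p + (i - 1)) x + zero_extension (\<omega> i) (\<delta> k i) x) \<in> H1 \<Omega>"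
    by (rule H1_add[OF \<Omega> IH zero_extension_H1[OF decomposition_open[OF dec i] \<Omega> d]])
  then show "w (k * p + i) \<in> H1 \<Omega>"
    by (rule H1_cong[OF _ ae])
qed

text \<open>
  Each correction is paired with all adjoint functions from its own step onwards by
  \<open>adjoint_tail_sum\<close>. Exchanging the sums, each adjoint function is paired with all corrections up to its
  step, that is with the iterate minus the initial guess.
\<close>

lemma schwarz_duality:
  assumes dec: "overlapping_decomposition \<Omega> p \<omega>" and \<Omega>: "open \<Omega>"
    and coeff: "elliptic_coefficients \<Omega> A b c"
    and pu: "partition_of_unity \<Omega> p \<omega> \<eta>" and \<psi>: "\<psi> \<in> L2 \<Omega>"
    and adj: "schwarz_adjoint A b c p \<omega> K \<eta> \<psi> \<phi>"
    and w: "w 0 \<in> H1 \<Omega>" "subdomain_corrections \<Omega> p \<omega> K w \<delta>"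
  shows "L2_inner \<Omega> \<psi> (w (K * p)) - L2_inner \<Omega> \<psi> (w 0) =
    (\<Sum>k<K. \<Sum>j=1..p. elliptic_form A b c (\<omega> j) (w (k * p + j)) (\<phi> k j) -
      elliptic_form A b c (\<omega> j) (w 0) (\<phi> k j))"
proof -
  note d = subdomain_correctionsD(1)[OF w(2)] and ae = subdomain_correctionsD(2)[OF w(2)]
  have wH1: "w (k * p + i) \<in> H1 \<Omega>" if "k < K" "i \<le> p" for k i
  proof (rule corrections_H1[OF dec \<Omega> w])
    have "k * p + i \<le> Suc k * p" using that by simp
    also have "\<dots> \<le> K * p" using that by (intro mult_le_mono1) simp
    finally show "k * p + i \<le> K * p" .
  qed
  have zH1: "zero_extension (\<omega> i) (\<delta> k i) \<in> H1 T" if "k < K" "i \<in> {1..p}" "open T" for k i T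
    by (rule zero_extension_H1[OF decomposition_open[OF dec that(2)] that(3) d[OF that(1,2)]])
  define \<alpha> where "\<alpha> q i k j = elliptic_form A b c (\<omega> i \<inter> \<omega> j) (\<delta> q i) (\<phi> k j)" for q i k j
  define \<beta> where "\<beta> q i = L2_inner \<Omega> \<psi> (zero_extension (\<omega> i) (\<delta> q i))" for q i
  have "L2_inner \<Omega> \<psi> (w (K * p)) = L2_inner \<Omega> \<psi> (w 0) + (\<Sum>q<K. \<Sum>i=1..p. \<beta> q i)"
  proof (rule sum_increments(1)[of K p "\<lambda>n. L2_inner \<Omega> \<psi> (w n)", OF _ order_refl])
    fix k i assume ki: "k < K" "i \<in> {1..p}"
    have "L2_inner \<Omega> \<psi> (w (k * p + i)) =
        L2_inner \<Omega> \<psi> (\<lambda>x. w (k * p + (i - 1)) x + zero_extension (\<omega> i) (\<delta> k i) x)"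
      unfolding L2_inner_def
      by (rule set_integral_cong_AE_lebesgue) (use ae[OF ki] in \<open>eventually_elim, simp\<close>)
    also have "\<dots> = L2_inner \<Omega> \<psi> (w (k * p + (i - 1))) + \<beta> k i"
      unfolding \<beta>_def using ki by (intro L2_inner_add_right \<psi> H1_L2[OF wH1] H1_L2[OF zH1] \<Omega>) auto
    finally show "L2_inner \<Omega> \<psi> (w (k * p + i)) = L2_inner \<Omega> \<psi> (w (k * p + (i - 1))) + \<beta> k i" .
  qed
  \<comment> \<open>Each correction against all adjoint functions from its own step onwards.\<close>
  also have "(\<Sum>q<K. \<Sum>i=1..p. \<beta> q i) =
      (\<Sum>q<K. \<Sum>i=1..p. (\<Sum>k=q+1..<K. \<Sum>j=1..p. \<alpha> q i k j) + (\<Sum>j=i..p. \<alpha> q i q j))"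
    unfolding \<alpha>_def \<beta>_def
    by (intro sum.cong refl adjoint_tail_sum[OF adj dec pu \<Omega> \<psi>, symmetric] d) auto
  also have "\<dots> = (\<Sum>q<K. \<Sum>k=q+1..<K. \<Sum>j=1..p. \<Sum>i=1..p. \<alpha> q i k j) +
      (\<Sum>q<K. \<Sum>j=1..p. \<Sum>i=1..j. \<alpha> q i q j)"
  proof -
    have "(\<Sum>i=1..p. \<Sum>k=q+1..<K. \<Sum>j=1..p. \<alpha> q i k j) = (\<Sum>k=q+1..<K. \<Sum>j=1..p. \<Sum>i=1..p. \<alpha> q i k j)" for q
      by (subst sum.swap) (intro sum.cong refl sum.swap)
    then show ?thesis by (simp only: sum.distrib sum_swap_lower_triangle_closed)
  qed
  \<comment> \<open>From here on each adjoint function is fixed and the corrections up to its step are summed.\<close>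
  also have "(\<Sum>q<K. \<Sum>k=q+1..<K. \<Sum>j=1..p. \<Sum>i=1..p. \<alpha> q i k j) =
      (\<Sum>k<K. \<Sum>q<k. \<Sum>j=1..p. \<Sum>i=1..p. \<alpha> q i k j)"
    by (rule sum_swap_lower_triangle[symmetric])
  also have "\<dots> = (\<Sum>k<K. \<Sum>j=1..p. \<Sum>q<k. \<Sum>i=1..p. \<alpha> q i k j)"
    by (intro sum.cong refl sum.swap)
  also have "\<dots> + (\<Sum>q<K. \<Sum>j=1..p. \<Sum>i=1..j. \<alpha> q i q j) =
      (\<Sum>k<K. \<Sum>j=1..p. (\<Sum>q<k. \<Sum>i=1..p. \<alpha> q i k j) + (\<Sum>i=1..j. \<alpha> k i k j))"
    by (simp only: sum.distrib)
  also have "\<dots> = (\<Sum>k<K. \<Sum>j=1..p. elliptic_form A b c (\<omega> j) (w (k * p + j)) (\<phi> k j) -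
      elliptic_form A b c (\<omega> j) (w 0) (\<phi> k j))"
  proof (intro sum.cong refl)
    fix k j assume "k \<in> {..<K}" and j: "j \<in> {1..p}"
    then have k: "k < K" and jp: "j \<le> p" by auto
    let ?a = "\<lambda>u. elliptic_form A b c (\<omega> j) u (\<phi> k j)"
    note oj = decomposition_open[OF dec j] and sj = decomposition_subset[OF dec j]
    have \<phi>: "\<phi> k j \<in> H1 (\<omega> j)" by (rule H10_H1[OF adjoint_in_H10[OF adj k j]])
    have "?a (w (k * p + j)) = ?a (w 0) + (\<Sum>q<k. \<Sum>i=1..p. \<alpha> q i k j) + (\<Sum>i=1..j. \<alpha> k i k j)"
    proof (rule sum_increments(2)[of K p "\<lambda>n. ?a (w n)" "\<lambda>q i. \<alpha> q i k j", OF _ k jp])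
      fix q i assume qi: "q < K" "i \<in> {1..p}"
      have wj: "w (q * p + (i - 1)) \<in> H1 (\<omega> j)"
        using qi by (intro H1_subset[OF wH1 oj sj]) auto
      note zj = zH1[OF qi oj]
      have "?a (w (q * p + i)) = ?a (\<lambda>x. w (q * p + (i - 1)) x + zero_extension (\<omega> i) (\<delta> q i) x)"
        by (rule elliptic_form_cong_left[symmetric, OF oj H1_add[OF oj wj zj] \<phi>])
           (use ae[OF qi] in \<open>eventually_elim, use sj in blast\<close>)
      also have "\<dots> = ?a (w (q * p + (i - 1))) + ?a (zero_extension (\<omega> i) (\<delta> q i))"
        by (rule elliptic_form_add_left[OF coeff oj sj wj zj \<phi>])
      also have "?a (zero_extension (\<omega> i) (\<delta> q i)) = \<alpha> q i k j"
        unfolding \<alpha>_def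
        by (rule elliptic_form_zero_extension[OF decomposition_open[OF dec qi(2)] oj d[OF qi] \<phi>, symmetric])
      finally show "?a (w (q * p + i)) = ?a (w (q * p + (i - 1))) + \<alpha> q i k j" .
    qed
    then show "(\<Sum>q<k. \<Sum>i=1..p. \<alpha> q i k j) + (\<Sum>i=1..j. \<alpha> k i k j) = ?a (w (k * p + j)) - ?a (w 0)"
      by simp
  qed
  finally show ?thesis by simp
qed

lemma continuum_corrections:
  assumes "schwarz_continuum A b c f \<Omega> p \<omega> K u ut"
  shows "subdomain_corrections \<Omega> p \<omega> K u (\<lambda>k i x. ut k i x - u (k * p + (i - 1)) x)"
  unfolding subdomain_corrections_def
proof (intro allI impI ballI conjI)
  fix k i assume ki: "k < K" "i \<in> {1..p}"
  show "(\<lambda>x. ut k i x - u (k * p + (i - 1)) x) \<in> H10 (\<omega> i)"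
    using assms ki by (auto simp: schwarz_continuum_def unique_solution_def dirichlet_solution_def)
  have "AE x in lebesgue. x \<in> \<omega> i \<longrightarrow> u (k * p + i) x = ut k i x"
    "AE x in lebesgue. x \<in> \<Omega> - \<omega> i \<longrightarrow> u (k * p + i) x = u (k * p + (i - 1)) x"
    using assms ki by (auto simp: schwarz_continuum_def)
  then show "AE x in lebesgue. x \<in> \<Omega> \<longrightarrow> u (k * p + i) x =
      u (k * p + (i - 1)) x + zero_extension (\<omega> i) (\<lambda>x. ut k i x - u (k * p + (i - 1)) x) x"
    by eventually_elim (auto simp: zero_extension_def)
qed

text \<open>
  The gluing of the discrete iterates prescribes the local solution on the closure of the subdomain;
  on its frontier this is compatible with the zero extension because functions in \<open>fe_space0\<close> vanish
  there pointwise.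
\<close>

lemma discrete_corrections:
  assumes dec: "overlapping_decomposition \<Omega> p \<omega>"
    and U: "schwarz_discrete \<T> r A b c f \<Omega> p \<omega> K U Ut"
  shows "subdomain_corrections \<Omega> p \<omega> K U (\<lambda>k i x. Ut k i x - U (k * p + (i - 1)) x)"
  unfolding subdomain_corrections_def
proof (intro allI impI ballI conjI)
  fix k i assume ki: "k < K" "i \<in> {1..p}"
  have fe: "(\<lambda>x. Ut k i x - U (k * p + (i - 1)) x) \<in> fe_space0 \<T> r (\<omega> i)"
    using U ki by (auto simp: schwarz_discrete_def unique_solution_def dirichlet_solution_def)
  then show "(\<lambda>x. Ut k i x - U (k * p + (i - 1)) x) \<in> H10 (\<omega> i)"
    by (simp add: fe_space0_def)
  have c: "\<forall>x\<in>closure (\<omega> i). U (k * p + i) x = Ut k i x"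
    and o: "\<forall>x\<in>\<Omega> - closure (\<omega> i). U (k * p + i) x = U (k * p + (i - 1)) x"
    using U ki by (auto simp: schwarz_discrete_def)
  show "AE x in lebesgue. x \<in> \<Omega> \<longrightarrow> U (k * p + i) x =
      U (k * p + (i - 1)) x + zero_extension (\<omega> i) (\<lambda>x. Ut k i x - U (k * p + (i - 1)) x) x"
  proof (intro AE_I2 impI)
    fix x assume x: "x \<in> \<Omega>"
    consider "x \<in> \<omega> i" | "x \<in> frontier (\<omega> i)" "x \<notin> \<omega> i" | "x \<notin> closure (\<omega> i)" "x \<notin> \<omega> i"
      using interior_subset[of "\<omega> i"] closure_subset[of "\<omega> i"] by (auto simp: frontier_def)
    then show "U (k * p + i) x =
      U (k * p + (i - 1)) x + zero_extension (\<omega> i) (\<lambda>x. Ut k i x - U (k * p + (i - 1)) x) x"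
    proof cases
      case 1
      then show ?thesis using c closure_subset[of "\<omega> i"] by (auto simp: zero_extension_def)
    next
      case 2
      then have "Ut k i x - U (k * p + (i - 1)) x = 0" "U (k * p + i) x = Ut k i x"
        using fe c by (auto simp: fe_space0_def frontier_def)
      then show ?thesis using 2 by (simp add: zero_extension_def)
    next
      case 3
      then show ?thesis using o x by (simp add: zero_extension_def)
    qed
  qed
qed

theorem theorem3:
  fixes \<Omega> :: "(real ^ 'n) set"
    and \<omega> :: "nat \<Rightarrow> (real ^ 'n) set"
    and p K r :: nat
    and A :: "real ^ 'n \<Rightarrow> real ^ 'n ^ 'n"
    and b :: "real ^ 'n \<Rightarrow> real ^ 'n"
    and c f \<psi> :: "real ^ 'n \<Rightarrow> real"
    and \<T> :: "(real ^ 'n) set set"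
    and \<eta> :: "nat \<Rightarrow> real ^ 'n \<Rightarrow> real"
    and u U :: "nat \<Rightarrow> real ^ 'n \<Rightarrow> real"
    and ut Ut \<phi> :: "nat \<Rightarrow> nat \<Rightarrow> real ^ 'n \<Rightarrow> real"
    and \<pi> :: "nat \<Rightarrow> (real ^ 'n \<Rightarrow> real) \<Rightarrow> (real ^ 'n \<Rightarrow> real)"
  assumes "open \<Omega>" "connected \<Omega>" "bounded \<Omega>" "\<Omega> \<noteq> {}"
    and "overlapping_decomposition \<Omega> p \<omega>"
    and "elliptic_coefficients \<Omega> A b c"
    and "f \<in> L2 \<Omega>" "\<psi> \<in> L2 \<Omega>"
    and "conforming_mesh \<T> \<Omega>" "mesh_consistent \<T> p \<omega>"
    and "partition_of_unity \<Omega> p \<omega> \<eta>"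
    and "1 \<le> K"
    and "U 0 \<in> fe_space0 \<T> r \<Omega>" "u 0 = U 0"
    and "schwarz_continuum A b c f \<Omega> p \<omega> K u ut"
    and "schwarz_discrete \<T> r A b c f \<Omega> p \<omega> K U Ut"
    and "schwarz_adjoint A b c p \<omega> K \<eta> \<psi> \<phi>"
    and "\<And>i v. i \<in> {1..p} \<Longrightarrow> v \<in> H10 (\<omega> i) \<Longrightarrow> \<pi> i v \<in> fe_space0 \<T> r (\<omega> i)"
  shows "L2_inner \<Omega> \<psi> (\<lambda>x. u (K * p) x - U (K * p) x) =
    (\<Sum>k<K. \<Sum>i=1..p. residual A b c f (\<omega> i) (Ut k i) (\<lambda>x. \<phi> k i x - \<pi> i (\<phi> k i) x))"
proof -
  note \<Omega> = \<open>open \<Omega>\<close> and dec = \<open>overlapping_decomposition \<Omega> p \<omega>\<close>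
    and coeff = \<open>elliptic_coefficients \<Omega> A b c\<close>
    and adj = \<open>schwarz_adjoint A b c p \<omega> K \<eta> \<psi> \<phi>\<close>
    and u = \<open>schwarz_continuum A b c f \<Omega> p \<omega> K u ut\<close>
    and U = \<open>schwarz_discrete \<T> r A b c f \<Omega> p \<omega> K U Ut\<close>
  have U0: "U 0 \<in> H1 \<Omega>" using \<open>U 0 \<in> fe_space0 \<T> r \<Omega>\<close> by (simp add: fe_space0_def fe_space_def)
  have u0: "u 0 \<in> H1 \<Omega>" using U0 \<open>u 0 = U 0\<close> by simp
  note uc = continuum_corrections[OF u] and Uc = discrete_corrections[OF dec U]
  note dual = schwarz_duality[OF dec \<Omega> coeff \<open>partition_of_unity \<Omega> p \<omega> \<eta>\<close> \<open>\<psi> \<in> L2 \<Omega>\<close> adj]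
  have "L2_inner \<Omega> \<psi> (\<lambda>x. u (K * p) x - U (K * p) x) =
      L2_inner \<Omega> \<psi> (u (K * p)) - L2_inner \<Omega> \<psi> (U (K * p))"
    by (intro L2_inner_diff_right \<open>\<psi> \<in> L2 \<Omega>\<close> H1_L2 corrections_H1[OF dec \<Omega> u0 uc] corrections_H1[OF dec \<Omega> U0 Uc])
       simp_all
  \<comment> \<open>Duality for \<open>u\<close> and for \<open>U\<close>; the terms of the common initial guess cancel.\<close>
  also have "\<dots> = (\<Sum>k<K. \<Sum>i=1..p. elliptic_form A b c (\<omega> i) (u (k * p + i)) (\<phi> k i) -
      elliptic_form A b c (\<omega> i) (U (k * p + i)) (\<phi> k i))"
    using dual[OF u0 uc] dual[OF U0 Uc] \<open>u 0 = U 0\<close> by (simp add: sum_subtractf)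
  also have "\<dots> = (\<Sum>k<K. \<Sum>i=1..p. residual A b c f (\<omega> i) (Ut k i) (\<lambda>x. \<phi> k i x - \<pi> i (\<phi> k i) x))"
  proof (intro sum.cong refl)
    fix k i assume "k \<in> {..<K}" and i: "i \<in> {1..p}"
    then have k: "k < K" by simp
    note oi = decomposition_open[OF dec i] and si = decomposition_subset[OF dec i]
    let ?a = "elliptic_form A b c (\<omega> i)" and ?l = "L2_inner (\<omega> i) f" and ?\<phi> = "\<phi> k i" and ?\<pi>\<phi> = "\<pi> i (\<phi> k i)"
    have \<phi>: "?\<phi> \<in> H10 (\<omega> i)" by (rule adjoint_in_H10[OF adj k i])
    have \<pi>: "?\<pi>\<phi> \<in> fe_space0 \<T> r (\<omega> i)" using assms(18)[OF i \<phi>] .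
    have H1: "?\<phi> \<in> H1 (\<omega> i)" "?\<pi>\<phi> \<in> H1 (\<omega> i)"
      using H10_H1[OF \<phi>] \<pi> by (auto simp: fe_space0_def fe_space_def)
    have ut: "ut k i \<in> H1 (\<omega> i)" "?a (ut k i) ?\<phi> = ?l ?\<phi>"
      "AE x in lebesgue. x \<in> \<omega> i \<longrightarrow> u (k * p + i) x = ut k i x"
      using u k i \<phi> by (auto simp: schwarz_continuum_def unique_solution_def dirichlet_solution_def)
    \<comment> \<open>The discrete problem is tested with \<open>?\<pi>\<phi>\<close> only: Galerkin orthogonality.\<close>
    have Ut: "Ut k i \<in> fe_space \<T> r (\<omega> i)" "?a (Ut k i) ?\<pi>\<phi> = ?l ?\<pi>\<phi>"
      "\<forall>x\<in>closure (\<omega> i). U (k * p + i) x = Ut k i x"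
      using U k i \<pi> by (auto simp: schwarz_discrete_def unique_solution_def dirichlet_solution_def)
    have UtH1: "Ut k i \<in> H1 (\<omega> i)" using Ut(1) by (simp add: fe_space_def)
    have "?a (u (k * p + i)) ?\<phi> = ?a (ut k i) ?\<phi>"
      by (rule elliptic_form_cong_left[symmetric, OF oi ut(1) H1(1)]) (use ut(3) in \<open>eventually_elim, auto\<close>)
    moreover have "?a (U (k * p + i)) ?\<phi> = ?a (Ut k i) ?\<phi>"
      by (rule elliptic_form_cong_left[symmetric, OF oi UtH1 H1(1)])
         (use Ut(3) closure_subset[of "\<omega> i"] in \<open>auto intro!: AE_I2\<close>)
    moreover have "?a (Ut k i) (\<lambda>x. ?\<phi> x - ?\<pi>\<phi> x) = ?a (Ut k i) ?\<phi> - ?a (Ut k i) ?\<pi>\<phi>"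
      by (rule elliptic_form_diff_right[OF coeff oi si UtH1 H1])
    moreover have "?l (\<lambda>x. ?\<phi> x - ?\<pi>\<phi> x) = ?l ?\<phi> - ?l ?\<pi>\<phi>"
      by (rule L2_inner_diff_right[OF L2_subset[OF \<open>f \<in> L2 \<Omega>\<close> si open_sets_lebesgue[OF oi]] H1[THEN H1_L2]])
    ultimately show "?a (u (k * p + i)) ?\<phi> - ?a (U (k * p + i)) ?\<phi> =
        residual A b c f (\<omega> i) (Ut k i) (\<lambda>x. ?\<phi> x - ?\<pi>\<phi> x)"
      using ut(2) Ut(2) by (simp add: residual_def)
  qed
  finally show ?thesis .
qed

end
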